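(* Let $G_1$ and $G_2$ be finitely generated torsion free nilpotent groups of class $2$ with cyclic center. Then $G_1$ and $G_2$ are geometrically equivalent if and only if their Mal'tsev completions are isomorphic, $\sqrt{G_1}\cong\sqrt{G_2}$.
   Context: Geometric equivalence. Let $\Theta$ be a variety of groups and, for a finite set $X$, let $W(X)$ be the free group of $\Theta$ over $X$. For $G\in\Theta$ and $T\subset W(X)$ put $T'_G=\{\mu\in \mathrm{Hom}(W(X),G)\mid T\subset\ker\mu\}$ and $T''_G=\bigcap_{\mu\in T'_G}\ker\mu\subset W(X)$. Groups $G_1,G_2\in\Theta$ are geometrically equivalent ($G_1\sim G_2$) if $T''_{G_1}=T''_{G_2}$ for every finite set $X$ and every $T\subset W(X)$. (It is known that $G_1\sim G_2$ if and only if every finitely generated subgroup $H$ of $G_1$ is approximated by $G_2$, i.e. there is a family $\{\varphi_i\}_{i\in I}\subset\mathrm{Hom}(H,G_2)$ with $\bigcap_{i}\ker\varphi_i=\{1\}$, and vice versa; so the notion does not depend on the variety $\Theta$ containing both groups.) Mal'tsev completion. For a torsion free nilpotent group $G$, $\sqrt{G}$ is the minimal torsion free nilpotent group containing $G$ such that for every $x\in\sqrt{G}$ and every $n\in\mathbb{N}$, $n\ge 1$, there is a (unique) $x^{1/n}\in\sqrt{G}$ with $(x^{1/n})^n=x$. It is nilpotent of the same class as $G$. *)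

theory Defs
  imports "HOL-Algebra.Elementary_Groups"
begin

section \<open>Finitely generated torsion free nilpotent groups\<close>

definition finitely_generated_group :: "('a, 'm) monoid_scheme \<Rightarrow> bool" where
  "finitely_generated_group G \<longleftrightarrow>
     (\<exists>S. finite S \<and> S \<subseteq> carrier G \<and> generate G S = carrier G)"

definition torsion_free_group :: "('a, 'm) monoid_scheme \<Rightarrow> bool" where
  "torsion_free_group G \<longleftrightarrow>
     (\<forall>x\<in>carrier G. \<forall>n::nat. n \<ge> 1 \<longrightarrow> x [^]\<^bsub>G\<^esub> n = \<one>\<^bsub>G\<^esub> \<longrightarrow> x = \<one>\<^bsub>G\<^esub>)"

definition group_center :: "('a, 'm) monoid_scheme \<Rightarrow> 'a set" where
  "group_center G = {z \<in> carrier G. \<forall>x\<in>carrier G. z \<otimes>\<^bsub>G\<^esub> x = x \<otimes>\<^bsub>G\<^esub> z}"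

text \<open>The series is indexed from 0, so that the trivial group is the only one of class 0.\<close>

primrec lower_central :: "('a, 'm) monoid_scheme \<Rightarrow> nat \<Rightarrow> 'a set" where
  "lower_central G 0 = carrier G"
| "lower_central G (Suc n) =
     generate G {x \<otimes>\<^bsub>G\<^esub> y \<otimes>\<^bsub>G\<^esub> inv\<^bsub>G\<^esub> x \<otimes>\<^bsub>G\<^esub> inv\<^bsub>G\<^esub> y | x y.
                   x \<in> lower_central G n \<and> y \<in> carrier G}"

definition nilpotent_of_class :: "nat \<Rightarrow> ('a, 'm) monoid_scheme \<Rightarrow> bool" where
  "nilpotent_of_class c G \<longleftrightarrow>
     group G \<and> lower_central G c = {\<one>\<^bsub>G\<^esub>} \<and> (\<forall>k<c. lower_central G k \<noteq> {\<one>\<^bsub>G\<^esub>})"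

definition nilpotent_group :: "('a, 'm) monoid_scheme \<Rightarrow> bool" where
  "nilpotent_group G \<longleftrightarrow> (\<exists>c. nilpotent_of_class c G)"


section \<open>Mal'tsev completion\<close>

definition maltsev_complete :: "('a, 'm) monoid_scheme \<Rightarrow> bool" where
  "maltsev_complete M \<longleftrightarrow>
     nilpotent_group M \<and> torsion_free_group M \<and>
     (\<forall>x\<in>carrier M. \<forall>n::nat. n \<ge> 1 \<longrightarrow> (\<exists>!y. y \<in> carrier M \<and> y [^]\<^bsub>M\<^esub> n = x))"

text \<open>The completion of a group is only determined up to isomorphism, so it is given by
  a predicate; the containment of \<open>G\<close> in \<open>M\<close> is an injective homomorphism \<open>\<iota>\<close>.\<close>

definition maltsev_completion :: "('a, 'm) monoid_scheme \<Rightarrow> ('b, 'n) monoid_scheme \<Rightarrow> bool" where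
  "maltsev_completion G M \<longleftrightarrow>
     maltsev_complete M \<and>
     (\<exists>\<iota>\<in>mon G M. \<forall>H. subgroup H M \<and> \<iota> ` carrier G \<subseteq> H \<and> maltsev_complete (M\<lparr>carrier := H\<rparr>)
         \<longrightarrow> H = carrier M)"


section \<open>Free groups and varieties of groups\<close>

text \<open>A letter \<open>(x, True)\<close> stands for \<open>x\<close> and \<open>(x, False)\<close> for its inverse.\<close>

type_synonym 'x gword = "('x \<times> bool) list"

abbreviation gwords :: "'x set \<Rightarrow> 'x gword set" where
  "gwords X \<equiv> lists (X \<times> UNIV)"

primrec word_val :: "('a, 'm) monoid_scheme \<Rightarrow> ('x \<Rightarrow> 'a) \<Rightarrow> 'x gword \<Rightarrow> 'a" where
  "word_val G v [] = \<one>\<^bsub>G\<^esub>"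
| "word_val G v (l # w) = (if snd l then v (fst l) else inv\<^bsub>G\<^esub> (v (fst l))) \<otimes>\<^bsub>G\<^esub> word_val G v w"

inductive_set free_rel :: "'x set \<Rightarrow> ('x gword \<times> 'x gword) set" for X where
  cancel: "\<lbrakk>u \<in> gwords X; w \<in> gwords X; x \<in> X\<rbrakk> \<Longrightarrow> (u @ [(x, b), (x, \<not> b)] @ w, u @ w) \<in> free_rel X"
| rfl: "u \<in> gwords X \<Longrightarrow> (u, u) \<in> free_rel X"
| symm: "(u, w) \<in> free_rel X \<Longrightarrow> (w, u) \<in> free_rel X"
| trns: "\<lbrakk>(u, w) \<in> free_rel X; (w, w') \<in> free_rel X\<rbrakk> \<Longrightarrow> (u, w') \<in> free_rel X"

definition free_group :: "'x set \<Rightarrow> 'x gword set monoid" where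
  "free_group X =
     \<lparr>carrier = gwords X // free_rel X,
      mult = (\<lambda>A B. \<Union>a\<in>A. \<Union>b\<in>B. free_rel X `` {a @ b}),
      one = free_rel X `` {[]}\<rparr>"

text \<open>A variety is given by a set \<open>\<Theta>\<close> of laws, words in countably many variables.\<close>

definition in_variety :: "nat gword set \<Rightarrow> ('a, 'm) monoid_scheme \<Rightarrow> bool" where
  "in_variety \<Theta> G \<longleftrightarrow>
     group G \<and> (\<forall>w\<in>\<Theta>. \<forall>v\<in>UNIV \<rightarrow> carrier G. word_val G v w = \<one>\<^bsub>G\<^esub>)"

definition verbal_subgroup :: "nat gword set \<Rightarrow> ('a, 'm) monoid_scheme \<Rightarrow> 'a set" where
  "verbal_subgroup \<Theta> G = generate G {word_val G v w | v w. v \<in> UNIV \<rightarrow> carrier G \<and> w \<in> \<Theta>}"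

definition variety_free_group :: "nat gword set \<Rightarrow> 'x set \<Rightarrow> 'x gword set set monoid" where
  "variety_free_group \<Theta> X = free_group X Mod verbal_subgroup \<Theta> (free_group X)"

definition variety_free_gen :: "nat gword set \<Rightarrow> 'x set \<Rightarrow> 'x \<Rightarrow> 'x gword set set" where
  "variety_free_gen \<Theta> X x =
     verbal_subgroup \<Theta> (free_group X) #>\<^bsub>free_group X\<^esub> (free_rel X `` {[(x, True)]})"


section \<open>Geometric equivalence\<close>

definition hom_points ::
    "nat gword set \<Rightarrow> 'x set \<Rightarrow> ('a, 'm) monoid_scheme \<Rightarrow> 'x gword set set set \<Rightarrow> ('x gword set set \<Rightarrow> 'a) set" where
  "hom_points \<Theta> X G T =
     {\<mu> \<in> hom (variety_free_group \<Theta> X) G. T \<subseteq> kernel (variety_free_group \<Theta> X) G \<mu>}"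

definition geom_closure ::
    "nat gword set \<Rightarrow> 'x set \<Rightarrow> ('a, 'm) monoid_scheme \<Rightarrow> 'x gword set set set \<Rightarrow> 'x gword set set set" where
  "geom_closure \<Theta> X G T =
     (\<Inter>\<mu>\<in>hom_points \<Theta> X G T. kernel (variety_free_group \<Theta> X) G \<mu>)"

text \<open>Every finite set is in bijection with a finite set of natural numbers, so
  ranging over the latter loses nothing.\<close>

definition geom_equivalent ::
    "nat gword set \<Rightarrow> ('a, 'm) monoid_scheme \<Rightarrow> ('b, 'n) monoid_scheme \<Rightarrow> bool" where
  "geom_equivalent \<Theta> G1 G2 \<longleftrightarrow>
     (\<forall>X::nat set. finite X \<longrightarrow>
        (\<forall>T\<subseteq>carrier (variety_free_group \<Theta> X). geom_closure \<Theta> X G1 T = geom_closure \<Theta> X G2 T))"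


section \<open>The relatively free groups have the universal property\<close>

lemma free_rel_words: "(u, w) \<in> free_rel X \<Longrightarrow> u \<in> gwords X \<and> w \<in> gwords X"
  by (induction rule: free_rel.induct) auto

lemma equiv_free_rel: "equiv (gwords X) (free_rel X)"
proof (rule equivI)
  show "free_rel X \<subseteq> gwords X \<times> gwords X" using free_rel_words by fastforce
  show "refl_on (gwords X) (free_rel X)"
    by (auto intro!: refl_onI free_rel.rfl simp del: in_lists_conv_set)
  show "sym (free_rel X)" by (auto intro: symI free_rel.symm)
  show "trans (free_rel X)" by (meson transI free_rel.trns)
qed

lemma free_rel_append_right:
  assumes "(u, w) \<in> free_rel X" "z \<in> gwords X" shows "(u @ z, w @ z) \<in> free_rel X"
  using assms
proof (induction rule: free_rel.induct)
  case (cancel u w x b)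
  then show ?case using free_rel.cancel[of u X "w @ z" x b] by auto
next
  case (rfl u)
  then show ?case by (intro free_rel.rfl) auto
qed (auto intro: free_rel.symm free_rel.trns)

lemma free_rel_append_left:
  assumes "(u, w) \<in> free_rel X" "z \<in> gwords X" shows "(z @ u, z @ w) \<in> free_rel X"
  using assms
proof (induction rule: free_rel.induct)
  case (cancel u w x b)
  then show ?case using free_rel.cancel[of "z @ u" X w x b] by auto
next
  case (rfl u)
  then show ?case by (intro free_rel.rfl) auto
qed (auto intro: free_rel.symm free_rel.trns)

lemma free_rel_append:
  assumes "(u, w) \<in> free_rel X" "(u', w') \<in> free_rel X" shows "(u @ u', w @ w') \<in> free_rel X"
  by (meson assms free_rel.trns free_rel_append_left free_rel_append_right free_rel_words)

lemma free_group_mult: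
  assumes "u \<in> gwords X" "w \<in> gwords X"
  shows "free_rel X `` {u} \<otimes>\<^bsub>free_group X\<^esub> free_rel X `` {w} = free_rel X `` {u @ w}"
proof -
  have "free_rel X `` {a @ b} = free_rel X `` {u @ w}"
    if "a \<in> free_rel X `` {u}" "b \<in> free_rel X `` {w}" for a b
  proof -
    have "(u @ w, a @ b) \<in> free_rel X" using that by (simp add: free_rel_append)
    then show ?thesis by (rule equiv_class_eq[OF equiv_free_rel, symmetric])
  qed
  moreover have "u \<in> free_rel X `` {u}" "w \<in> free_rel X `` {w}"
    using assms by (simp_all add: free_rel.rfl del: in_lists_conv_set)
  ultimately have "(\<Union>a\<in>free_rel X `` {u}. \<Union>b\<in>free_rel X `` {w}. free_rel X `` {a @ b})
      = free_rel X `` {u @ w}"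
    by blast
  then show ?thesis by (simp add: free_group_def)
qed

lemma free_group_carrier_cases:
  assumes "A \<in> carrier (free_group X)"
  obtains u where "u \<in> gwords X" "A = free_rel X `` {u}"
proof -
  from assms have "A \<in> gwords X // free_rel X" by (simp add: free_group_def)
  then show ?thesis by (rule quotientE) (rule that)
qed

lemma free_class_in_carrier: "u \<in> gwords X \<Longrightarrow> free_rel X `` {u} \<in> carrier (free_group X)"
  by (simp add: free_group_def quotientI del: in_lists_conv_set)

lemma free_group_one: "\<one>\<^bsub>free_group X\<^esub> = free_rel X `` {[]}"
  by (simp add: free_group_def)

lemma free_rel_cancel_inv:
  assumes "u \<in> gwords X"
  shows "(rev (map (\<lambda>(x, b). (x, \<not> b)) u) @ u, []) \<in> free_rel X"
  using assms
proof (induction u rule: list.induct)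
  case (Cons l u)
  obtain x b where l: "l = (x, b)" by (cases l)
  let ?r = "rev (map (\<lambda>(x, b). (x, \<not> b)) u)"
  have "?r \<in> gwords X" using Cons.prems by force
  then have "(?r @ [(x, \<not> b), (x, \<not> \<not> b)] @ u, ?r @ u) \<in> free_rel X"
    using Cons.prems l by (intro free_rel.cancel) auto
  with Cons show ?case using l by (auto intro: free_rel.trns)
qed (auto intro: free_rel.rfl)

lemma group_free_group: "group (free_group X)"
proof (rule groupI)
  fix A B assume A: "A \<in> carrier (free_group X)" and B: "B \<in> carrier (free_group X)"
  show "A \<otimes>\<^bsub>free_group X\<^esub> B \<in> carrier (free_group X)"
    using A B by (elim free_group_carrier_cases)
      (simp add: free_group_mult free_class_in_carrier del: in_lists_conv_set)
  fix C assume C: "C \<in> carrier (free_group X)"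
  show "A \<otimes>\<^bsub>free_group X\<^esub> B \<otimes>\<^bsub>free_group X\<^esub> C = A \<otimes>\<^bsub>free_group X\<^esub> (B \<otimes>\<^bsub>free_group X\<^esub> C)"
    using A B C by (elim free_group_carrier_cases)
      (simp add: free_group_mult del: in_lists_conv_set)
next
  show "\<one>\<^bsub>free_group X\<^esub> \<in> carrier (free_group X)"
    by (simp add: free_group_one free_class_in_carrier)
next
  fix A assume A: "A \<in> carrier (free_group X)"
  then obtain u where u: "u \<in> gwords X" "A = free_rel X `` {u}" by (rule free_group_carrier_cases)
  show "\<one>\<^bsub>free_group X\<^esub> \<otimes>\<^bsub>free_group X\<^esub> A = A"
    using u free_group_mult[of "[]" X u] by (simp add: free_group_one)
  let ?r = "rev (map (\<lambda>(x, b). (x, \<not> b)) u)"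
  have r: "?r \<in> gwords X" using u(1) by force
  have "free_rel X `` {?r} \<otimes>\<^bsub>free_group X\<^esub> A = \<one>\<^bsub>free_group X\<^esub>"
    using equiv_class_eq[OF equiv_free_rel free_rel_cancel_inv[OF u(1)]]
    by (simp only: u(2) free_group_mult[OF r u(1)] free_group_one)
  then show "\<exists>B\<in>carrier (free_group X). B \<otimes>\<^bsub>free_group X\<^esub> A = \<one>\<^bsub>free_group X\<^esub>"
    using free_class_in_carrier[OF r] by blast
qed

context group
begin

lemma word_val_closed:
  "\<lbrakk>v \<in> X \<rightarrow> carrier G; w \<in> gwords X\<rbrakk> \<Longrightarrow> word_val G v w \<in> carrier G"
  by (induction w) (auto simp: Pi_iff)

lemma word_val_append:
  assumes "v \<in> X \<rightarrow> carrier G" "u \<in> gwords X" "w \<in> gwords X"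
  shows "word_val G v (u @ w) = word_val G v u \<otimes> word_val G v w"
  using assms(2)
proof (induction u rule: list.induct)
  case Nil
  then show ?case using word_val_closed[OF assms(1,3)] by simp
next
  case (Cons l u)
  have "u \<in> gwords X" "v (fst l) \<in> carrier G"
    using Cons.prems assms(1) by auto
  then show ?case
    using Cons.IH word_val_closed[OF assms(1,3)] word_val_closed[OF assms(1) \<open>u \<in> gwords X\<close>]
    by (simp add: m_assoc)
qed

lemma word_val_hom:
  assumes "group H" "h \<in> hom G H" "v \<in> X \<rightarrow> carrier G" "w \<in> gwords X"
  shows "h (word_val G v w) = word_val H (h \<circ> v) w"
proof -
  interpret h: group_hom G H h by (simp add: assms group_hom.intro group_hom_axioms.intro is_group)
  show ?thesis using assms(4)
  proof (induction w rule: list.induct)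
    case (Cons l w)
    have "w \<in> gwords X" "v (fst l) \<in> carrier G"
      using Cons.prems assms(3) by auto
    then show ?case
      using Cons.IH word_val_closed[OF assms(3) \<open>w \<in> gwords X\<close>] by simp
  qed simp
qed

lemma word_val_free_rel:
  assumes "(u, w) \<in> free_rel X" "v \<in> X \<rightarrow> carrier G"
  shows "word_val G v u = word_val G v w"
  using assms(1)
proof (induction rule: free_rel.induct)
  case (cancel u w x b)
  have "v x \<in> carrier G" using assms(2) cancel by auto
  moreover have "word_val G v ([(x, b), (x, \<not> b)] @ w) = word_val G v w"
    using calculation word_val_closed[OF assms(2) cancel(2)]
    by (cases b) (auto simp: m_assoc[symmetric])
  moreover have "[(x, b), (x, \<not> b)] @ w \<in> gwords X" using cancel by auto
  ultimately show ?case using cancel assms(2) by (simp only: word_val_append)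
qed auto

lemma verbal_subgroup_normal: "verbal_subgroup \<Theta> G \<lhd> G"
proof -
  let ?S = "{word_val G v w | v w. v \<in> UNIV \<rightarrow> carrier G \<and> w \<in> \<Theta>}"
  have UN: "w \<in> gwords UNIV" for w :: "nat gword" by auto
  have "g \<otimes> s \<otimes> inv g \<in> ?S" if s: "s \<in> ?S" and g: "g \<in> carrier G" for s g
  proof -
    obtain v w where vw: "v \<in> UNIV \<rightarrow> carrier G" "w \<in> \<Theta>" "s = word_val G v w" using s by auto
    have "(\<lambda>x. g \<otimes> x \<otimes> inv g) \<in> hom G G"
    proof (rule homI)
      fix x y assume xy: "x \<in> carrier G" "y \<in> carrier G"
      have "g \<otimes> x \<otimes> inv g \<otimes> (g \<otimes> y \<otimes> inv g) = g \<otimes> x \<otimes> (inv g \<otimes> g) \<otimes> y \<otimes> inv g"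
        using g xy by (simp only: m_assoc m_closed inv_closed)
      then show "g \<otimes> (x \<otimes> y) \<otimes> inv g = g \<otimes> x \<otimes> inv g \<otimes> (g \<otimes> y \<otimes> inv g)"
        using g xy by (simp add: m_assoc)
    qed (use g in auto)
    from word_val_hom[OF is_group this vw(1) UN[of w]]
    have "g \<otimes> s \<otimes> inv g = word_val G ((\<lambda>x. g \<otimes> x \<otimes> inv g) \<circ> v) w" using vw by simp
    moreover have "((\<lambda>x. g \<otimes> x \<otimes> inv g) \<circ> v) \<in> UNIV \<rightarrow> carrier G"
      using g vw(1) by (simp add: Pi_iff)
    ultimately show ?thesis using vw(2) by blast
  qed
  moreover have "?S \<subseteq> carrier G" using word_val_closed UN by blast
  ultimately show ?thesis unfolding verbal_subgroup_def by (intro normal_generateI) auto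
qed

end

lemma in_variety_variety_free_group: "in_variety \<Theta> (variety_free_group \<Theta> X)"
proof -
  interpret F: group "free_group X" by (rule group_free_group)
  let ?N = "verbal_subgroup \<Theta> (free_group X)"
  interpret N: normal ?N "free_group X" by (rule F.verbal_subgroup_normal)
  let ?q = "\<lambda>a. ?N #>\<^bsub>free_group X\<^esub> a"
  have "word_val (free_group X Mod ?N) v w = \<one>\<^bsub>free_group X Mod ?N\<^esub>"
    if w: "w \<in> \<Theta>" and v: "v \<in> UNIV \<rightarrow> carrier (free_group X Mod ?N)" for v w
  proof -
    have "\<forall>i. \<exists>a. a \<in> carrier (free_group X) \<and> v i = ?q a"
      using v by (auto simp: FactGroup_def RCOSETS_def Pi_iff)
    then obtain v' where v': "\<And>i. v' i \<in> carrier (free_group X)" "\<And>i. v i = ?q (v' i)" by metis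
    have "?q (word_val (free_group X) v' w) = word_val (free_group X Mod ?N) (?q \<circ> v') w"
      using v' by (intro F.word_val_hom[where X = UNIV] N.factorgroup_is_group N.r_coset_hom_Mod) auto
    moreover have "?q \<circ> v' = v" using v' by auto
    moreover have "word_val (free_group X) v' w \<in> ?N"
      using w v' unfolding verbal_subgroup_def by (intro generate.incl) blast
    ultimately show ?thesis
      using F.coset_join2 N.subgroup_axioms N.subset by (auto simp: FactGroup_def)
  qed
  then show ?thesis
    using N.factorgroup_is_group by (simp add: in_variety_def variety_free_group_def)
qed

lemma variety_free_group_universal:
  assumes "in_variety \<Theta> G" "f \<in> X \<rightarrow> carrier G"
  shows "\<exists>h\<in>hom (variety_free_group \<Theta> X) G. \<forall>x\<in>X. h (variety_free_gen \<Theta> X x) = f x"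
proof -
  interpret F: group "free_group X" by (rule group_free_group)
  interpret G: group G using assms(1) by (simp add: in_variety_def)
  define k where "k A = the_elem (word_val G f ` A)" for A
  have k: "k (free_rel X `` {u}) = word_val G f u" if "u \<in> gwords X" for u
  proof -
    have "word_val G f ` (free_rel X `` {u}) = {word_val G f u}"
    proof (intro equalityI image_subsetI)
      fix w assume "w \<in> free_rel X `` {u}"
      then show "word_val G f w \<in> {word_val G f u}"
        using G.word_val_free_rel[OF _ assms(2), of u w] by simp
    qed (use free_rel.rfl[OF that] in auto)
    then show ?thesis by (simp add: k_def)
  qed
  have k_hom: "k \<in> hom (free_group X) G"
  proof (rule homI)
    fix A B assume "A \<in> carrier (free_group X)" "B \<in> carrier (free_group X)"
    then obtain u w where u: "u \<in> gwords X" "A = free_rel X `` {u}"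
      and w: "w \<in> gwords X" "B = free_rel X `` {w}"
      by (metis free_group_carrier_cases)
    have uw: "u @ w \<in> gwords X" using u(1) w(1) by auto
    show "k A \<in> carrier G"
      using G.word_val_closed[OF assms(2) u(1)] k[OF u(1)] u(2) by simp
    show "k (A \<otimes>\<^bsub>free_group X\<^esub> B) = k A \<otimes>\<^bsub>G\<^esub> k B"
      unfolding u(2) w(2) free_group_mult[OF u(1) w(1)] k[OF u(1)] k[OF w(1)] k[OF uw]
      by (rule G.word_val_append[OF assms(2) u(1) w(1)])
  qed
  interpret k: group_hom "free_group X" G k
    by (simp add: group_hom_def group_hom_axioms_def k_hom)
  have "verbal_subgroup \<Theta> (free_group X) \<subseteq> kernel (free_group X) G k"
    unfolding verbal_subgroup_def
  proof (rule F.generate_subgroup_incl[OF _ k.subgroup_kernel], safe)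
    fix v :: "nat \<Rightarrow> _" and w assume v: "v \<in> UNIV \<rightarrow> carrier (free_group X)" and w: "w \<in> \<Theta>"
    have W: "w \<in> gwords UNIV" by auto
    have "k (word_val (free_group X) v w) = word_val G (k \<circ> v) w"
      by (rule F.word_val_hom[OF G.is_group k_hom v W])
    also have "word_val G (k \<circ> v) w = \<one>\<^bsub>G\<^esub>"
      using assms(1) v w by (simp add: in_variety_def Pi_iff)
    finally show "word_val (free_group X) v w \<in> kernel (free_group X) G k"
      using F.word_val_closed[OF v W] by (simp add: kernel_def)
  qed
  then obtain h where h: "h \<in> hom (variety_free_group \<Theta> X) G"
    "\<And>a. a \<in> carrier (free_group X) \<Longrightarrow>
       h (verbal_subgroup \<Theta> (free_group X) #>\<^bsub>free_group X\<^esub> a) = k a"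
    using k.FactGroup_universal_kernel[OF F.verbal_subgroup_normal]
    unfolding variety_free_group_def by metis
  have "h (variety_free_gen \<Theta> X x) = f x" if "x \<in> X" for x
  proof -
    have x: "[(x, True)] \<in> gwords X" using that by auto
    have "f x \<in> carrier G" using that assms(2) by auto
    then show ?thesis
      using h(2)[OF free_class_in_carrier[OF x]] k[OF x] by (simp add: variety_free_gen_def)
  qed
  with h(1) show ?thesis by blast
qed

lemma free_group_generated:
  "carrier (free_group X) = generate (free_group X) ((\<lambda>x. free_rel X `` {[(x, True)]}) ` X)"
  (is "_ = generate _ ?S")
proof
  interpret F: group "free_group X" by (rule group_free_group)
  have S: "?S \<subseteq> carrier (free_group X)"
    by (auto intro!: free_class_in_carrier)
  then show "generate (free_group X) ?S \<subseteq> carrier (free_group X)"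
    by (rule F.generate_incl)
  have gen: "free_rel X `` {[(x, b)]} \<in> generate (free_group X) ?S" if x: "x \<in> X" for x b
  proof (cases b)
    case True
    then show ?thesis using x by (auto intro: generate.incl)
  next
    case False
    have w: "[(x, True)] \<in> gwords X" "[(x, False)] \<in> gwords X" using x by auto
    have "([] @ [(x, False), (x, \<not> False)] @ [], [] @ []) \<in> free_rel X"
      by (rule free_rel.cancel) (use x in auto)
    then have "free_rel X `` {[(x, False)]} \<otimes>\<^bsub>free_group X\<^esub> free_rel X `` {[(x, True)]}
        = \<one>\<^bsub>free_group X\<^esub>"
      unfolding free_group_mult[OF w(2,1)] free_group_one
      by (intro equiv_class_eq[OF equiv_free_rel]) simp
    then have "free_rel X `` {[(x, False)]} = inv\<^bsub>free_group X\<^esub> (free_rel X `` {[(x, True)]})"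
      using F.inv_equality[OF _ free_class_in_carrier[OF w(1)] free_class_in_carrier[OF w(2)]] by simp
    then show ?thesis using False x by (auto intro: generate.inv)
  qed
  have "free_rel X `` {u} \<in> generate (free_group X) ?S" if "u \<in> gwords X" for u
    using that
  proof (induction u rule: list.induct)
    case Nil
    then show ?case using generate.one[of "free_group X" ?S] by (simp add: free_group_one)
  next
    case (Cons l u)
    obtain x b where l: "l = (x, b)" by (cases l)
    have x: "x \<in> X" "u \<in> gwords X" "[(x, b)] \<in> gwords X" using Cons.prems l by auto
    show ?case
      using generate.eng[OF gen[OF x(1), of b] Cons.IH[OF x(2)]] l
      unfolding free_group_mult[OF x(3,2)] by simp
  qed
  then show "carrier (free_group X) \<subseteq> generate (free_group X) ?S"
    using free_group_carrier_cases by blast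
qed

lemma variety_free_group_generated:
  "carrier (variety_free_group \<Theta> X) = generate (variety_free_group \<Theta> X) (variety_free_gen \<Theta> X ` X)"
proof -
  interpret F: group "free_group X" by (rule group_free_group)
  let ?N = "verbal_subgroup \<Theta> (free_group X)"
  let ?S = "(\<lambda>x. free_rel X `` {[(x, True)]}) ` X"
  interpret N: normal ?N "free_group X" by (rule F.verbal_subgroup_normal)
  interpret q: group_hom "free_group X" "free_group X Mod ?N" "\<lambda>a. ?N #>\<^bsub>free_group X\<^esub> a"
    by (simp add: group_hom_def group_hom_axioms_def N.factorgroup_is_group N.r_coset_hom_Mod)
  have "?S \<subseteq> carrier (free_group X)" by (auto intro!: free_class_in_carrier)
  from q.generate_img[OF this] show ?thesis
    unfolding free_group_generated[symmetric] variety_free_group_def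
    by (auto simp: FactGroup_def RCOSETS_def image_image variety_free_gen_def)
qed

end

theory Submission
  imports Defs
begin

text \<open>A geometric equivalence yields a homomorphism \<open>G\<^sub>1 \<rightarrow> G\<^sub>2\<close> that does not kill a generator of the
  centre of \<open>G\<^sub>1\<close>; as every nontrivial normal subgroup meets the centre, it is injective. With an
  embedding \<open>G\<^sub>2 \<rightarrow> G\<^sub>1\<close> in the other direction, a rank argument shows that every element of \<open>G\<^sub>2\<close> has a
  power in the image of \<open>G\<^sub>1\<close>, so both groups have the same completion.
  Conversely, two finitely generated groups with a common completion \<open>M\<close> embed into each other:
  a complement of the centre in the Lie ring of \<open>M\<close> gives dilations of \<open>M\<close>, acting as \<open>N\<close>
  modulo the centre and as \<open>N\<^sup>2\<close> on it, and for suitable \<open>N\<close> they carry one group into the other.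
  Mutually embedded groups have the same closures.\<close>


section \<open>Integer linear algebra\<close>

text \<open>A completion is given only by nilpotency, unique roots and minimality, so neither its
  class nor a Lie ring structure may be assumed. The root calculus therefore supposes class two of a
  subgroup alone and derives the rest from uniqueness of roots. Cyclicity of the centre allows a
  single homomorphism in place of a separating family: a map into a torsion free group that does not
  kill a generator of the centre is injective on the centre. It also turns commutators into
  integers, so that ranks can be compared by linear algebra. No theory of rank is set up; instead
  the two embeddings are composed to an injective endomorphism. In the converse direction every
  element of one group has a power in the other, but \<open>x \<mapsto> x^N\<close> is not a
  homomorphism: its defect is \<open>[x,y]^(N choose 2)\<close>. A dilation is the power map
  corrected by a central factor that cancels this defect, and the factor is constructed one
  generator at a time by extracting roots.\<close>

lemma int_vectors_dependent:
  fixes e :: "'i \<Rightarrow> 's \<Rightarrow> int"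
  assumes "finite S" "finite I" "card S < card I"
  shows "\<exists>c. (\<exists>i\<in>I. c i \<noteq> 0) \<and> (\<forall>s\<in>S. (\<Sum>i\<in>I. c i * e i s) = 0)"
  using assms
proof (induction S arbitrary: I e rule: finite_induct)
  case empty
  then have "I \<noteq> {}" by auto
  then show ?case by (intro exI[of _ "\<lambda>_. 1"]) auto
next
  case (insert s S)
  show ?case
  proof (cases "\<forall>i\<in>I. e i s = 0")
    case True
    have "card S < card I" using insert by simp
    from insert.IH[OF insert.prems(1) this, of e] True show ?thesis by auto
  next
    case False
    then obtain p where p: "p \<in> I" "e p s \<noteq> 0" by auto
    let ?J = "I - {p}"
    \<comment> \<open>Elimination without division: cross-multiplying with the pivot
      \<open>p\<close> clears coordinate \<open>s\<close> over the integers.\<close>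
    let ?e = "\<lambda>i t. e p s * e i t - e i s * e p t"
    have "card S < card ?J" using insert p by simp
    from insert.IH[OF _ this, of ?e] insert.prems obtain c where
      c: "\<exists>i\<in>?J. c i \<noteq> 0" "\<And>t. t \<in> S \<Longrightarrow> (\<Sum>i\<in>?J. c i * ?e i t) = 0" by auto
    \<comment> \<open>The coefficient of \<open>p\<close> makes this combination of the
      \<open>e i\<close> equal to the given one of the eliminated vectors; scaling by
      \<open>e p s \<noteq> 0\<close> preserves a nonzero coefficient.\<close>
    define c' where "c' i = (if i = p then - (\<Sum>j\<in>?J. c j * e j s) else c i * e p s)" for i
    have "(\<Sum>i\<in>I. c' i * e i t) = (\<Sum>i\<in>?J. c i * ?e i t)" for t
    proof -
      have "(\<Sum>i\<in>I. c' i * e i t) = c' p * e p t + (\<Sum>i\<in>?J. c' i * e i t)"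
        using p insert.prems by (simp add: sum.remove)
      also have "(\<Sum>i\<in>?J. c' i * e i t) = (\<Sum>i\<in>?J. c i * e p s * e i t)"
        by (intro sum.cong) (auto simp: c'_def)
      also have "c' p * e p t = - (\<Sum>i\<in>?J. c i * e i s * e p t)"
        by (simp add: c'_def sum_distrib_right)
      finally show ?thesis
        by (simp add: right_diff_distrib sum_subtractf mult.assoc)
    qed
    moreover have "(\<Sum>i\<in>?J. c i * ?e i t) = 0" if "t \<in> insert s S" for t
      using c(2) that by (cases "t = s") auto
    moreover have "\<exists>i\<in>I. c' i \<noteq> 0" using c(1) p by (auto simp: c'_def)
    ultimately show ?thesis by (intro exI[of _ c']) simp
  qed
qed


section \<open>Groups of nilpotency class two\<close>

definition commutator :: "('a, 'm) monoid_scheme \<Rightarrow> 'a \<Rightarrow> 'a \<Rightarrow> 'a" where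
  "commutator G x y = x \<otimes>\<^bsub>G\<^esub> y \<otimes>\<^bsub>G\<^esub> inv\<^bsub>G\<^esub> x \<otimes>\<^bsub>G\<^esub> inv\<^bsub>G\<^esub> y"

lemma in_centerD:
  assumes "z \<in> group_center G"
  shows "z \<in> carrier G" "x \<in> carrier G \<Longrightarrow> z \<otimes>\<^bsub>G\<^esub> x = x \<otimes>\<^bsub>G\<^esub> z"
  using assms by (auto simp: group_center_def)

context group
begin

lemma commutator_closed [simp]:
  "x \<in> carrier G \<Longrightarrow> y \<in> carrier G \<Longrightarrow> commutator G x y \<in> carrier G"
  by (simp add: commutator_def)

text \<open>Reading the commutator as the factor in
  \<open>x \<otimes> y = c \<otimes> (y \<otimes> x)\<close> removes inverses from most computations
  below.\<close>

lemma commutator_eq_iff: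
  assumes "x \<in> carrier G" "y \<in> carrier G" "c \<in> carrier G"
  shows "commutator G x y = c \<longleftrightarrow> x \<otimes> y = c \<otimes> (y \<otimes> x)"
proof -
  have "commutator G x y = (x \<otimes> y) \<otimes> inv (y \<otimes> x)"
    using assms by (simp add: commutator_def inv_mult_group m_assoc)
  then show ?thesis using assms inv_solve_right'[of c "x \<otimes> y" "y \<otimes> x"]
    by simp
qed

lemma mult_commutator:
  assumes "x \<in> carrier G" "y \<in> carrier G"
  shows "x \<otimes> y = commutator G x y \<otimes> (y \<otimes> x)"
  using assms commutator_eq_iff[of x y "commutator G x y"] by simp

lemma commutator_eq_one_iff:
  assumes "x \<in> carrier G" "y \<in> carrier G"
  shows "commutator G x y = \<one> \<longleftrightarrow> x \<otimes> y = y \<otimes> x"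
  using assms commutator_eq_iff[of x y \<one>] by simp

lemma commutator_swap:
  assumes "x \<in> carrier G" "y \<in> carrier G"
  shows "commutator G y x = inv (commutator G x y)"
  using assms by (simp add: commutator_def inv_mult_group m_assoc)

lemma subgroup_center: "subgroup (group_center G) G"
proof (rule subgroupI)
  fix a assume a: "a \<in> group_center G"
  note D = in_centerD[OF this]
  have "inv a \<otimes> x = x \<otimes> inv a" if x: "x \<in> carrier G" for x
  proof -
    have "x = x \<otimes> a \<otimes> inv a" using D(1) x by (simp add: m_assoc)
    also have "\<dots> = a \<otimes> (x \<otimes> inv a)"
      using D(1) x by (simp only: D(2)[OF x, symmetric] m_assoc inv_closed)
    finally have "inv a \<otimes> x = inv a \<otimes> (a \<otimes> (x \<otimes> inv a))" by (rule arg_cong)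
    then show ?thesis using D(1) x by (simp add: m_assoc[symmetric])
  qed
  then show "inv a \<in> group_center G" using D(1) by (simp add: group_center_def)
  fix b assume b: "b \<in> group_center G"
  note E = in_centerD[OF this]
  have "a \<otimes> b \<otimes> x = x \<otimes> (a \<otimes> b)" if x: "x \<in> carrier G" for x
  proof -
    have "a \<otimes> b \<otimes> x = a \<otimes> x \<otimes> b" using D(1) E(1) x by (simp only: m_assoc E(2)[OF x])
    also have "\<dots> = x \<otimes> (a \<otimes> b)" using D(1) E(1) x by (simp only: m_assoc D(2)[OF x])
    finally show ?thesis .
  qed
  then show "a \<otimes> b \<in> group_center G" using D(1) E(1) by (simp add: group_center_def)
qed (auto simp: group_center_def)

lemma center_mult_commute:
  "z \<in> group_center G \<Longrightarrow> x \<in> carrier G \<Longrightarrow> z \<otimes> x = x \<otimes> z"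
  by (rule in_centerD)

lemma center_left_commute:
  "z \<in> group_center G \<Longrightarrow> x \<in> carrier G \<Longrightarrow> y \<in> carrier G \<Longrightarrow> x \<otimes> (z \<otimes> y) = z \<otimes> (x \<otimes> y)"
  using in_centerD[of z G] m_assoc[of x z y] m_assoc[of z x y] by simp

lemma center_closed [simp]:
  "\<one> \<in> group_center G"
  "z \<in> group_center G \<Longrightarrow> w \<in> group_center G \<Longrightarrow> z \<otimes> w \<in> group_center G"
  "z \<in> group_center G \<Longrightarrow> inv z \<in> group_center G"
  "z \<in> group_center G \<Longrightarrow> z [^] (k::int) \<in> group_center G"
  "z \<in> group_center G \<Longrightarrow> z [^] (n::nat) \<in> group_center G"
proof -
  interpret Z: subgroup "group_center G" G by (rule subgroup_center)
  show "\<one> \<in> group_center G" by simp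
  show "w \<in> group_center G \<Longrightarrow> z \<otimes> w \<in> group_center G" if "z \<in> group_center G"
    using that by simp
  show "inv z \<in> group_center G" if "z \<in> group_center G" using that by simp
  show k: "z [^] (k::int) \<in> group_center G" if "z \<in> group_center G" for k
    using that by (rule subgroup_int_pow_closed[OF subgroup_center])
  show "z [^] (n::nat) \<in> group_center G" if "z \<in> group_center G"
    using k[OF that, of "int n"] by (simp add: int_pow_int)
qed

lemma pow_mult_commute:
  assumes "x \<in> carrier G" "y \<in> carrier G" "x \<otimes> y = y \<otimes> x"
  shows "x [^] (n::nat) \<otimes> y = y \<otimes> x [^] n"
  using assms by (simp add: group_commutes_pow)

lemma mult_pow_twisted:
  assumes "x \<in> carrier G" "y \<in> carrier G" "d \<in> carrier G"
    and "x \<otimes> y = d \<otimes> (y \<otimes> x)" "d \<otimes> x = x \<otimes> d" "d \<otimes> y = y \<otimes> d"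
  shows "x \<otimes> y [^] (n::nat) = d [^] n \<otimes> (y [^] n \<otimes> x)"
proof (induction n)
  case (Suc n)
  have "x \<otimes> y [^] Suc n = x \<otimes> y [^] n \<otimes> y" using assms by (simp add: m_assoc)
  also have "\<dots> = d [^] n \<otimes> y [^] n \<otimes> (x \<otimes> y)" using assms Suc by (simp add: m_assoc)
  also have "\<dots> = d [^] n \<otimes> (y [^] n \<otimes> d) \<otimes> (y \<otimes> x)" using assms by (simp add: m_assoc)
  also have "y [^] n \<otimes> d = d \<otimes> y [^] n" using assms by (simp add: pow_mult_commute)
  finally show ?case using assms by (simp add: m_assoc)
qed (use assms in simp)

text \<open>Hall's power formula in class two; the exponent is 0 + 1 + ... + (n - 1), since passing
  \<open>x\<close> over \<open>y [^] n\<close> costs \<open>d [^] n\<close>. Only \<open>x\<close>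
  and \<open>y\<close> have to commute with \<open>d\<close>, so the formula applies before the
  ambient group is known to have class two.\<close>

lemma mult_pow_class2:
  assumes "x \<in> carrier G" "y \<in> carrier G" "d \<in> carrier G"
    and "x \<otimes> y = d \<otimes> (y \<otimes> x)" "d \<otimes> x = x \<otimes> d" "d \<otimes> y = y \<otimes> d"
  shows "(x \<otimes> y) [^] (n::nat) \<otimes> d [^] (n choose 2) = x [^] n \<otimes> y [^] n"
proof (induction n)
  case (Suc n)
  have ch: "Suc n choose 2 = (n choose 2) + n"
    by (simp add: numeral_2_eq_2)
  have dxy: "d \<otimes> (x \<otimes> y) = x \<otimes> y \<otimes> d" using assms by (metis m_assoc)
  have "(x \<otimes> y) [^] Suc n \<otimes> d [^] (Suc n choose 2)
      = (x \<otimes> y) [^] n \<otimes> ((x \<otimes> y) \<otimes> d [^] ((n choose 2) + n))"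
    using assms ch by (simp add: m_assoc)
  also have "(x \<otimes> y) \<otimes> d [^] ((n choose 2) + n) = d [^] ((n choose 2) + n) \<otimes> (x \<otimes> y)"
    using pow_mult_commute[OF assms(3) _ dxy] assms by simp
  also have "\<dots> = d [^] (n choose 2) \<otimes> (d [^] n \<otimes> (x \<otimes> y))"
    using assms by (simp add: nat_pow_mult[symmetric] m_assoc)
  also have "(x \<otimes> y) [^] n \<otimes> \<dots> = x [^] n \<otimes> y [^] n \<otimes> (d [^] n \<otimes> (x \<otimes> y))"
    using assms Suc by (simp add: m_assoc[symmetric])
  also have "\<dots> = x [^] n \<otimes> (y [^] n \<otimes> d [^] n \<otimes> x) \<otimes> y"
    using assms by (simp add: m_assoc)
  also have "y [^] n \<otimes> d [^] n = d [^] n \<otimes> y [^] n"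
    using assms by (metis nat_pow_closed pow_mult_commute)
  also have "d [^] n \<otimes> y [^] n \<otimes> x = x \<otimes> y [^] n"
    using mult_pow_twisted[OF assms] assms by (simp add: m_assoc)
  finally show ?case using assms nat_pow_Suc2[of y n] by (simp add: m_assoc)
qed (simp add: numeral_2_eq_2)

end

text \<open>Class at most two, abelian groups included: for isolators and completions only this
  upper bound is established.\<close>

locale two_step_group = group +
  assumes commutator_central:
    "x \<in> carrier G \<Longrightarrow> y \<in> carrier G \<Longrightarrow> commutator G x y \<in> group_center G"
begin

lemma commutator_mult_left:
  assumes "x \<in> carrier G" "y \<in> carrier G" "w \<in> carrier G"
  shows "commutator G (x \<otimes> y) w = commutator G x w \<otimes> commutator G y w"
proof -
  let ?a = "commutator G x w" and ?b = "commutator G y w"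
  have "x \<otimes> y \<otimes> w = x \<otimes> (?b \<otimes> (w \<otimes> y))"
    using assms mult_commutator[of y w] by (simp add: m_assoc)
  also have "\<dots> = ?b \<otimes> (x \<otimes> w \<otimes> y)"
    using assms center_left_commute[OF commutator_central, of y w x] by (simp add: m_assoc)
  also have "\<dots> = ?b \<otimes> (?a \<otimes> (w \<otimes> x) \<otimes> y)"
    using assms mult_commutator[of x w] by simp
  also have "\<dots> = ?a \<otimes> ?b \<otimes> (w \<otimes> (x \<otimes> y))"
    using assms center_left_commute[OF commutator_central, of x w ?b] by (simp add: m_assoc)
  finally show ?thesis using assms by (simp add: commutator_eq_iff)
qed

lemma commutator_mult_right:
  assumes "x \<in> carrier G" "y \<in> carrier G" "w \<in> carrier G"
  shows "commutator G w (x \<otimes> y) = commutator G w x \<otimes> commutator G w y"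
proof -
  have "commutator G w (x \<otimes> y) = inv (commutator G x w \<otimes> commutator G y w)"
    using assms by (simp add: commutator_swap[of "x \<otimes> y" w] commutator_mult_left)
  also have "\<dots> = inv (commutator G y w \<otimes> commutator G x w)"
    using assms commutator_central center_mult_commute by simp
  also have "\<dots> = commutator G w x \<otimes> commutator G w y"
    using assms by (simp add: inv_mult_group commutator_swap[of _ w])
  finally show ?thesis .
qed

lemma commutator_int_pow_left:
  assumes "x \<in> carrier G" "y \<in> carrier G"
  shows "commutator G (x [^] (k::int)) y = commutator G x y [^] k"
proof -
  have "(\<lambda>x. commutator G x y) \<in> hom G G"
    using assms by (intro homI) (auto simp: commutator_mult_left)
  from hom_int_pow[OF this assms(1) is_group is_group] show ?thesis by simp
qed

lemma commutator_int_pow_right: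
  assumes "x \<in> carrier G" "y \<in> carrier G"
  shows "commutator G x (y [^] (k::int)) = commutator G x y [^] k"
proof -
  have "(\<lambda>y. commutator G x y) \<in> hom G G"
    using assms by (intro homI) (auto simp: commutator_mult_right)
  from hom_int_pow[OF this assms(2) is_group is_group] show ?thesis by simp
qed

lemma commutator_nat_pow_left:
  assumes "x \<in> carrier G" "y \<in> carrier G"
  shows "commutator G (x [^] (k::nat)) y = commutator G x y [^] k"
  using commutator_int_pow_left[OF assms, of "int k"] by (simp add: int_pow_int)

end

lemma (in group_hom) hom_commutator:
  assumes "x \<in> carrier G" "y \<in> carrier G"
  shows "h (commutator G x y) = commutator H (h x) (h y)"
  using assms by (simp add: commutator_def)

lemma nilpotent_of_class_2D:
  fixes G (structure)
  assumes "nilpotent_of_class 2 G"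
  shows "two_step_group G" and "\<exists>x\<in>carrier G. \<exists>y\<in>carrier G. commutator G x y \<noteq> \<one>"
proof -
  interpret group G using assms by (simp add: nilpotent_of_class_def)
  define D where "D = {commutator G x y | x y. x \<in> carrier G \<and> y \<in> carrier G}"
  define E where "E = {commutator G x y | x y. x \<in> generate G D \<and> y \<in> carrier G}"
  have 1: "lower_central G (Suc 0) = generate G D" by (simp add: commutator_def D_def)
  have "lower_central G (Suc (Suc 0)) = {\<one>}"
    using assms by (simp add: nilpotent_of_class_def numeral_2_eq_2)
  then have E1: "generate G E = {\<one>}"
    by (simp add: commutator_def D_def E_def)
  have E: "c = \<one>" if "c \<in> E" for c
    using generate.incl[OF that, of G] E1 by simp
  show "two_step_group G"
  proof unfold_locales
    fix x y assume xy: "x \<in> carrier G" "y \<in> carrier G"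
    have "commutator G x y \<in> D" using xy unfolding D_def by blast
    then have "commutator G x y \<in> generate G D" by (rule generate.incl)
    then have "commutator G (commutator G x y) w \<in> E" if "w \<in> carrier G" for w
      using that unfolding E_def by blast
    then have "commutator G (commutator G x y) w = \<one>" if "w \<in> carrier G" for w
      using E that by simp
    then show "commutator G x y \<in> group_center G"
      using xy by (simp add: group_center_def commutator_eq_one_iff)
  qed
  show "\<exists>x\<in>carrier G. \<exists>y\<in>carrier G. commutator G x y \<noteq> \<one>"
  proof (rule ccontr)
    assume "\<not> ?thesis"
    then have "D \<subseteq> {\<one>}" unfolding D_def by auto
    then have "lower_central G (Suc 0) = {\<one>}"
      using generate_subgroup_incl[OF _ triv_subgroup] generate.one[of G D] unfolding 1 by auto
    then show False using assms by (simp add: nilpotent_of_class_def del: lower_central.simps)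
  qed
qed

lemma (in two_step_group) nilpotent: "nilpotent_group G"
proof -
  let ?D = "{commutator G x y | x y. x \<in> carrier G \<and> y \<in> carrier G}"
  have "?D \<subseteq> group_center G" using commutator_central by auto
  then have 1: "lower_central G (Suc 0) \<subseteq> group_center G"
    using generate_subgroup_incl[OF _ subgroup_center] by (simp add: commutator_def)
  then have "{x \<otimes> y \<otimes> inv x \<otimes> inv y | x y. x \<in> lower_central G (Suc 0) \<and> y \<in> carrier G} \<subseteq> {\<one>}"
  proof -
    have "x \<otimes> y \<otimes> inv x \<otimes> inv y = \<one>" if "x \<in> lower_central G (Suc 0)" "y \<in> carrier G" for x y
    proof -
      have "x \<in> group_center G" using 1 that by blast
      from in_centerD[OF this] that(2) have "x \<in> carrier G" "x \<otimes> y = y \<otimes> x" by auto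
      with that(2) commutator_eq_one_iff[of x y] show ?thesis by (simp only: commutator_def)
    qed
    then show ?thesis by blast
  qed
  then have "lower_central G 2 \<subseteq> {\<one>}"
    using generate_subgroup_incl[OF _ triv_subgroup] by (simp add: numeral_2_eq_2)
  then have "lower_central G 2 = {\<one>}"
    by (auto simp: numeral_2_eq_2 intro: generate.one)
  \<comment> \<open>The class may be 0, 1 or 2, and \<open>nilpotent_of_class\<close> asks for the
    exact one, hence the least index.\<close>
  then have "\<exists>c. lower_central G c = {\<one>} \<and> (\<forall>k<c. lower_central G k \<noteq> {\<one>})"
    using exists_least_iff[of "\<lambda>c. lower_central G c = {\<one>}"] by blast
  then show ?thesis by (simp add: nilpotent_group_def nilpotent_of_class_def is_group)
qed


section \<open>Groups with unique roots\<close>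

lemma (in group) conj_nat_pow:
  assumes "x \<in> carrier G" "y \<in> carrier G"
  shows "(y \<otimes> x \<otimes> inv y) [^] (n::nat) = y \<otimes> x [^] n \<otimes> inv y"
proof (induction n)
  case (Suc n)
  have "(y \<otimes> x \<otimes> inv y) [^] Suc n = y \<otimes> x [^] n \<otimes> (inv y \<otimes> y) \<otimes> x \<otimes> inv y"
    using assms Suc by (simp only: nat_pow_Suc m_assoc m_closed inv_closed nat_pow_closed)
  then show ?case using assms by (simp add: m_assoc)
qed (use assms in simp)

locale root_group = group +
  assumes root_ex1:
    "x \<in> carrier G \<Longrightarrow> n \<ge> (1::nat) \<Longrightarrow> \<exists>!y. y \<in> carrier G \<and> y [^] n = x"
begin

lemma root_unique:
  assumes "x \<in> carrier G" "y \<in> carrier G" "n \<ge> (1::nat)" "x [^] n = y [^] n"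
  shows "x = y"
  using root_ex1[of "x [^] n" n] assms by auto

lemma root_exists:
  assumes "x \<in> carrier G" "n \<ge> (1::nat)"
  obtains y where "y \<in> carrier G" "y [^] n = x"
  using root_ex1[OF assms] by auto

lemma pow_eq_one:
  assumes "x \<in> carrier G" "n \<ge> (1::nat)" "x [^] n = \<one>"
  shows "x = \<one>"
  using root_unique[of x \<one> n] assms by simp

text \<open>The conjugate of \<open>x\<close> by \<open>y\<close> has the same \<open>n\<close>-th
  power as \<open>x\<close>, so uniqueness of roots identifies the two.\<close>

lemma commute_of_pow:
  assumes "x \<in> carrier G" "y \<in> carrier G" "n \<ge> (1::nat)" "x [^] n \<otimes> y = y \<otimes> x [^] n"
  shows "x \<otimes> y = y \<otimes> x"
proof -
  have "(y \<otimes> x \<otimes> inv y) [^] n = x [^] n \<otimes> y \<otimes> inv y"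
    using assms by (simp only: conj_nat_pow)
  also have "\<dots> = x [^] n" using assms(1,2) by (simp add: m_assoc)
  finally have "y \<otimes> x \<otimes> inv y = x" using assms(1-3) root_unique by simp
  then show ?thesis using assms(1,2) inv_solve_right'[of x "y \<otimes> x" y] by simp
qed

text \<open>The root \<open>d\<close> of the commutator of \<open>x\<^sup>n\<close> and \<open>y\<^sup>n\<close> is the commutator of \<open>x\<close> and \<open>y\<close>:
  comparing \<open>n\<close>-th powers, first \<open>x\<^sup>n y x\<^sup>-\<^sup>n = d\<^sup>n y\<close> and then \<open>d y x y\<^sup>-\<^sup>1 = x\<close>.\<close>

lemma commutator_root:
  assumes "x \<in> carrier G" "y \<in> carrier G" "c \<in> carrier G" "n \<ge> (1::nat)"
    and xy: "x [^] n \<otimes> y [^] n = c \<otimes> (y [^] n \<otimes> x [^] n)"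
    and cx: "c \<otimes> x [^] n = x [^] n \<otimes> c" and cy: "c \<otimes> y [^] n = y [^] n \<otimes> c"
  obtains d where "d \<in> carrier G" "d [^] (n * n) = c" "x \<otimes> y = d \<otimes> (y \<otimes> x)"
    "d \<otimes> x = x \<otimes> d" "d \<otimes> y = y \<otimes> d"
proof -
  have nn: "n * n \<ge> 1" using assms(4) by simp
  obtain d where d: "d \<in> carrier G" "d [^] (n * n) = c" using root_exists[OF assms(3) nn] .
  have "x \<otimes> c = c \<otimes> x" by (rule commute_of_pow[OF assms(1,3,4) cx[symmetric]])
  then have dx: "d \<otimes> x = x \<otimes> d" by (intro commute_of_pow[OF d(1) assms(1) nn]) (simp only: d(2))
  have "y \<otimes> c = c \<otimes> y" by (rule commute_of_pow[OF assms(2,3,4) cy[symmetric]])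
  then have dy: "d \<otimes> y = y \<otimes> d" by (intro commute_of_pow[OF d(1) assms(2) nn]) (simp only: d(2))
  have dn: "d [^] n \<in> carrier G" and xn: "x [^] n \<in> carrier G" and yn: "y [^] n \<in> carrier G"
    using d(1) assms by auto
  have "(x [^] n \<otimes> y \<otimes> inv (x [^] n)) [^] n = (c \<otimes> y [^] n) \<otimes> (x [^] n \<otimes> inv (x [^] n))"
    by (simp only: conj_nat_pow[OF assms(2) xn] xy) (simp only: m_assoc assms(1-3) xn yn m_closed inv_closed)
  also have "\<dots> = d [^] (n * n) \<otimes> y [^] n" using assms(3) xn yn by (simp add: d(2))
  also have "\<dots> = (d [^] n) [^] n \<otimes> y [^] n" by (simp only: nat_pow_pow[OF d(1)])
  also have "\<dots> = (d [^] n \<otimes> y) [^] n"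
    by (rule pow_mult_distrib[symmetric, OF pow_mult_commute[OF d(1) assms(2) dy] dn assms(2)])
  finally have "x [^] n \<otimes> y \<otimes> inv (x [^] n) = d [^] n \<otimes> y"
    using root_unique[OF _ _ assms(4)] xn dn assms(2) by simp
  then have 1: "x [^] n \<otimes> y = d [^] n \<otimes> y \<otimes> x [^] n"
    using inv_solve_right'[of "d [^] n \<otimes> y" "x [^] n \<otimes> y" "x [^] n"] xn dn assms(2) by simp
  let ?w = "y \<otimes> x \<otimes> inv y"
  have w: "?w \<in> carrier G" using assms by simp
  have "d \<otimes> inv y = inv y \<otimes> d"
    using dy d(1) assms(2)
    by (metis inv_closed inv_solve_left inv_solve_right m_assoc m_closed)
  then have dw: "d \<otimes> ?w = ?w \<otimes> d"
    using d(1) assms(1,2) dx dy by (metis inv_closed m_assoc m_closed)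
  have "(d \<otimes> ?w) [^] n = d [^] n \<otimes> ?w [^] n" by (rule pow_mult_distrib[OF dw d(1) w])
  also have "\<dots> = (d [^] n \<otimes> y \<otimes> x [^] n) \<otimes> inv y"
    unfolding conj_nat_pow[OF assms(1,2)]
    using dn xn assms(1,2) by (simp only: m_assoc m_closed inv_closed)
  also have "\<dots> = x [^] n" unfolding 1[symmetric] using xn assms(2) by (simp add: m_assoc)
  finally have "d \<otimes> ?w = x" using root_unique[OF _ _ assms(4)] d(1) w assms(1) by simp
  then have "x \<otimes> y = d \<otimes> ?w \<otimes> y" by simp
  also have "\<dots> = d \<otimes> (y \<otimes> x)" using d(1) assms(1,2) by (simp add: m_assoc)
  finally show ?thesis using that d dx dy by blast
qed

text \<open>The exponent is chosen so that \<open>2 * n * n choose 2\<close> is the multiple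
  \<open>n * n * (2 * n * n - 1)\<close> of \<open>n * n\<close>. The commutator \<open>d\<close> of
  \<open>x\<close> and \<open>y\<close>, an \<open>n * n\<close>-th root of \<open>c\<close>, then
  enters only through a power of \<open>c\<close>.\<close>

lemma mult_pow_root:
  assumes "x \<in> carrier G" "y \<in> carrier G" "c \<in> carrier G" "n \<ge> (1::nat)"
    and "x [^] n \<otimes> y [^] n = c \<otimes> (y [^] n \<otimes> x [^] n)"
    and "c \<otimes> x [^] n = x [^] n \<otimes> c" and "c \<otimes> y [^] n = y [^] n \<otimes> c"
  shows "(x \<otimes> y) [^] (2 * n * n) \<otimes> c [^] (2 * n * n - 1) = (x [^] n) [^] (2 * n) \<otimes> (y [^] n) [^] (2 * n)"
proof -
  obtain d where d: "d \<in> carrier G" "d [^] (n * n) = c" "x \<otimes> y = d \<otimes> (y \<otimes> x)"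
    "d \<otimes> x = x \<otimes> d" "d \<otimes> y = y \<otimes> d"
    using commutator_root[OF assms] .
  have "2 * n * n choose 2 = (n * n) * (2 * n * n - 1)"
    by (simp add: choose_two)
  then have "d [^] (2 * n * n choose 2) = c [^] (2 * n * n - 1)"
    by (simp only: nat_pow_pow[OF d(1), of "n * n", symmetric] d(2))
  moreover have "(z [^] n) [^] (2 * n) = z [^] (2 * n * n)" if "z \<in> carrier G" for z
    by (simp only: nat_pow_pow[OF that] mult_ac)
  ultimately show ?thesis
    using mult_pow_class2[OF assms(1,2) d(1,3-5), of "2 * n * n"] assms(1,2) by simp
qed

end

lemma maltsev_complete_root_group: "maltsev_complete M \<Longrightarrow> root_group M"
  unfolding maltsev_complete_def nilpotent_group_def nilpotent_of_class_def
  by (auto simp: root_group_def root_group_axioms_def)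

section \<open>Isolators of class two subgroups\<close>

definition isolator :: "('a, 'm) monoid_scheme \<Rightarrow> 'a set \<Rightarrow> 'a set" where
  "isolator G K = {x \<in> carrier G. \<exists>n::nat. n \<ge> 1 \<and> x [^]\<^bsub>G\<^esub> n \<in> K}"

lemma (in group) isolator_common_exponent:
  assumes "subgroup K G" "x \<in> isolator G K" "y \<in> isolator G K"
  obtains n :: nat where "n \<ge> 1" "x [^] n \<in> K" "y [^] n \<in> K"
proof -
  have K: "a [^] (k::nat) \<in> K" if "a \<in> K" for a k
    using subgroup_int_pow_closed[OF assms(1) that, of "int k"] by (simp add: int_pow_int)
  obtain m k :: nat where mk: "m \<ge> 1" "k \<ge> 1" "x [^] m \<in> K" "y [^] k \<in> K"
    and xy: "x \<in> carrier G" "y \<in> carrier G"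
    using assms(2,3) by (auto simp: isolator_def)
  have "x [^] (m * k) \<in> K" using K[OF mk(3), of k] by (simp only: nat_pow_pow[OF xy(1)])
  moreover have "y [^] (m * k) \<in> K"
    using K[OF mk(4), of m] by (simp only: nat_pow_pow[OF xy(2)] mult.commute)
  ultimately show ?thesis using that[of "m * k"] mk(1,2) by simp
qed

text \<open>The position of the image of a class two group in its completion: commutators of
  \<open>K\<close> are required to commute with \<open>K\<close> only, and nothing is said about the
  class of \<open>G\<close>.\<close>

locale two_step_subgroup = root_group + subgroup K G for K +
  assumes commutator_commute:
    "x \<in> K \<Longrightarrow> y \<in> K \<Longrightarrow> w \<in> K \<Longrightarrow> commutator G x y \<otimes> w = w \<otimes> commutator G x y"
begin

lemma commutator_in: "x \<in> K \<Longrightarrow> y \<in> K \<Longrightarrow> commutator G x y \<in> K"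
  by (simp add: commutator_def m_closed m_inv_closed)

lemma nat_pow_in: "x \<in> K \<Longrightarrow> x [^] (k::nat) \<in> K"
  using subgroup_int_pow_closed[OF subgroup_axioms, of x "int k"] by (simp add: int_pow_int)

text \<open>A power of the product becomes a fixed word in two elements of \<open>K\<close>. This
  closes the isolator under products and, as homomorphisms preserve the word, makes extensions to
  roots multiplicative.\<close>

lemma mult_pow_in:
  assumes "x \<in> carrier G" "y \<in> carrier G" "n \<ge> (1::nat)" "x [^] n \<in> K" "y [^] n \<in> K"
  defines "c \<equiv> commutator G (x [^] n) (y [^] n)"
  shows "(x \<otimes> y) [^] (2 * n * n)
    = (x [^] n) [^] (2 * n) \<otimes> (y [^] n) [^] (2 * n) \<otimes> inv (c [^] (2 * n * n - 1))"
proof -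
  have c: "c \<in> K" unfolding c_def using assms by (simp add: commutator_in)
  have "(x \<otimes> y) [^] (2 * n * n) \<otimes> c [^] (2 * n * n - 1)
      = (x [^] n) [^] (2 * n) \<otimes> (y [^] n) [^] (2 * n)"
    using assms(1-5) c
    by (intro mult_pow_root mult_commutator[folded c_def] commutator_commute[folded c_def])
      (auto simp: c_def intro!: mult_commutator commutator_commute)
  then show ?thesis using assms(1,2) c by (subst inv_solve_right) auto
qed

text \<open>The commutator of \<open>x\<close> and \<open>y\<close> is a root of a commutator of
  elements of \<open>K\<close>, and \<open>w\<close> is a root of an element of \<open>K\<close>;
  commuting passes from powers to roots.\<close>

lemma isolator_commutator_commute:
  assumes "x \<in> isolator G K" "y \<in> isolator G K" "w \<in> isolator G K"
  shows "commutator G x y \<otimes> w = w \<otimes> commutator G x y"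
proof -
  have X: "x \<in> carrier G" "y \<in> carrier G" "w \<in> carrier G" using assms by (auto simp: isolator_def)
  obtain n :: nat where n: "n \<ge> 1" "x [^] n \<in> K" "y [^] n \<in> K"
    using isolator_common_exponent[OF subgroup_axioms assms(1,2)] .
  obtain m :: nat where m: "m \<ge> 1" "w [^] m \<in> K" using assms(3) by (auto simp: isolator_def)
  define c where "c = commutator G (x [^] n) (y [^] n)"
  have c: "c \<in> carrier G" "\<And>a. a \<in> K \<Longrightarrow> c \<otimes> a = a \<otimes> c"
    unfolding c_def using n X commutator_commute by auto
  have xy: "x [^] n \<otimes> y [^] n = c \<otimes> (y [^] n \<otimes> x [^] n)"
    unfolding c_def by (rule mult_commutator) (use X in auto)
  obtain d where d: "d \<in> carrier G" "d [^] (n * n) = c" "x \<otimes> y = d \<otimes> (y \<otimes> x)"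
    using commutator_root[OF X(1,2) c(1) n(1) xy c(2)[OF n(2)] c(2)[OF n(3)]] by metis
  have "w \<otimes> c = c \<otimes> w" by (rule commute_of_pow[OF X(3) c(1) m(1) c(2)[OF m(2), symmetric]])
  then have "d \<otimes> w = w \<otimes> d"
    using n(1) by (intro commute_of_pow[OF d(1) X(3), of "n * n"]) (simp_all only: d(2), simp)
  moreover have "commutator G x y = d" using commutator_eq_iff[OF X(1,2) d(1)] d(3) by simp
  ultimately show ?thesis by simp
qed

lemma subgroup_isolator: "subgroup (isolator G K) G"
proof (rule subgroupI)
  show "isolator G K \<subseteq> carrier G" by (auto simp: isolator_def)
  have "\<one> \<in> isolator G K" by (auto simp: isolator_def intro!: exI[of _ 1])
  then show "isolator G K \<noteq> {}" by auto
  show "inv a \<in> isolator G K" if "a \<in> isolator G K" for a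
    using that m_inv_closed by (auto simp: isolator_def nat_pow_inv)
  fix a b assume ab: "a \<in> isolator G K" "b \<in> isolator G K"
  then have X: "a \<in> carrier G" "b \<in> carrier G" by (auto simp: isolator_def)
  obtain n :: nat where n: "n \<ge> 1" "a [^] n \<in> K" "b [^] n \<in> K"
    using isolator_common_exponent[OF subgroup_axioms ab] .
  have "(a \<otimes> b) [^] (2 * n * n) \<in> K"
    unfolding mult_pow_in[OF X n]
    by (intro m_closed m_inv_closed nat_pow_in commutator_in n)
  moreover have "2 * n * n \<ge> 1" using n(1) by simp
  ultimately show "a \<otimes> b \<in> isolator G K" using X unfolding isolator_def by blast
qed

lemma two_step_isolator: "two_step_group (G\<lparr>carrier := isolator G K\<rparr>)"
proof -
  interpret H: subgroup "isolator G K" G by (rule subgroup_isolator)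
  interpret I: group "G\<lparr>carrier := isolator G K\<rparr>" by (rule H.subgroup_is_group[OF is_group])
  have [simp]: "commutator (G\<lparr>carrier := isolator G K\<rparr>) x y = commutator G x y"
    if "x \<in> isolator G K" "y \<in> isolator G K" for x y
    using that by (simp add: commutator_def m_inv_consistent[OF subgroup_isolator])
  show ?thesis
  proof unfold_locales
    fix x y
    assume xy: "x \<in> carrier (G\<lparr>carrier := isolator G K\<rparr>)" "y \<in> carrier (G\<lparr>carrier := isolator G K\<rparr>)"
    show "commutator (G\<lparr>carrier := isolator G K\<rparr>) x y \<in> group_center (G\<lparr>carrier := isolator G K\<rparr>)"
      using xy I.commutator_closed[OF xy] isolator_commutator_commute by (simp add: group_center_def)
  qed
qed

lemma maltsev_complete_isolator: "maltsev_complete (G\<lparr>carrier := isolator G K\<rparr>)"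
proof -
  have "\<exists>!y. y \<in> isolator G K \<and> y [^] n = x" if x: "x \<in> isolator G K" and n: "n \<ge> 1" for x and n :: nat
  proof -
    have X: "x \<in> carrier G" using x by (simp add: isolator_def)
    obtain y where y: "y \<in> carrier G" "y [^] n = x" using root_exists[OF X n] .
    obtain m :: nat where m: "m \<ge> 1" "x [^] m \<in> K" using x by (auto simp: isolator_def)
    have "y [^] (n * m) \<in> K" using m(2) y(2) nat_pow_pow[OF y(1), of n m] by simp
    moreover have "n * m \<ge> 1" using n m(1) by simp
    ultimately have "y \<in> isolator G K" using y(1) unfolding isolator_def by blast
    moreover have "z = y" if "z \<in> isolator G K" "z [^] n = x" for z
      using that y root_unique[OF _ _ n] by (simp add: isolator_def)
    ultimately show ?thesis using y by blast
  qed
  moreover have "x = \<one>" if "x \<in> isolator G K" "n \<ge> 1" "x [^] n = \<one>" for x and n :: nat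
    using that pow_eq_one by (simp add: isolator_def)
  ultimately show ?thesis
    using two_step_group.nilpotent[OF two_step_isolator]
    by (simp add: maltsev_complete_def torsion_free_group_def nat_pow_consistent[symmetric])
qed

end

lemma hom_image_two_step:
  assumes "two_step_group G" "root_group M" "f \<in> hom G M"
  shows "two_step_subgroup M (f ` carrier G)"
proof -
  interpret G: two_step_group G by fact
  interpret M: root_group M by fact
  interpret f: group_hom G M f
    using assms(3) by (simp add: group_hom_def group_hom_axioms_def G.is_group M.is_group)
  interpret S: subgroup "f ` carrier G" M by (rule f.img_is_subgroup)
  show ?thesis
  proof unfold_locales
    fix x y w assume "x \<in> f ` carrier G" "y \<in> f ` carrier G" "w \<in> f ` carrier G"
    then obtain a b c where abc: "a \<in> carrier G" "b \<in> carrier G" "c \<in> carrier G"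
      and eq: "x = f a" "y = f b" "w = f c" by auto
    have "f (commutator G a b \<otimes>\<^bsub>G\<^esub> c) = f (c \<otimes>\<^bsub>G\<^esub> commutator G a b)"
      using in_centerD(2)[OF G.commutator_central[OF abc(1,2)] abc(3)] by (rule arg_cong)
    then show "commutator M x y \<otimes>\<^bsub>M\<^esub> w = w \<otimes>\<^bsub>M\<^esub> commutator M x y"
      using abc by (simp add: eq f.hom_commutator[symmetric])
  qed
qed

text \<open>By minimality a completion is the isolator of the group inside it.\<close>

lemma maltsev_completionD:
  assumes "maltsev_completion G M" "two_step_group G"
  obtains \<iota> where "\<iota> \<in> mon G M" "root_group M" "two_step_group M"
    "isolator M (\<iota> ` carrier G) = carrier M"
proof -
  have M: "root_group M"
    using assms(1) unfolding maltsev_completion_def by (intro maltsev_complete_root_group) blast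
  obtain \<iota> where \<iota>: "\<iota> \<in> mon G M"
    and min: "\<And>H. subgroup H M \<Longrightarrow> \<iota> ` carrier G \<subseteq> H \<Longrightarrow> maltsev_complete (M\<lparr>carrier := H\<rparr>) \<Longrightarrow> H = carrier M"
    using assms(1) by (auto simp: maltsev_completion_def)
  interpret two_step_subgroup M "\<iota> ` carrier G"
    using hom_image_two_step[OF assms(2) M] \<iota> by (simp add: mon_def)
  have "\<iota> ` carrier G \<subseteq> isolator M (\<iota> ` carrier G)"
  proof
    fix x assume "x \<in> \<iota> ` carrier G"
    then show "x \<in> isolator M (\<iota> ` carrier G)" using subset
      by (auto simp: isolator_def intro!: exI[of _ 1])
  qed
  then have eq: "isolator M (\<iota> ` carrier G) = carrier M"
    using min subgroup_isolator maltsev_complete_isolator by blast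
  have "two_step_group M" using two_step_isolator by (simp add: eq)
  then show ?thesis using that \<iota> M eq by blast
qed


section \<open>Extending homomorphisms to the completion\<close>

text \<open>An element whose \<open>n\<close>-th power is \<open>\<iota> g\<close> can only go to
  the \<open>n\<close>-th root of \<open>f g\<close>. Raising to the product of two exponents and
  using that \<open>\<iota>\<close> is injective shows independence of \<open>n\<close> and
  \<open>g\<close>.\<close>

lemma hom_extends_to_roots:
  fixes G :: "('a, 'm) monoid_scheme" and M :: "('b, 'n) monoid_scheme" and N :: "('c, 'k) monoid_scheme"
  assumes "two_step_group G" "root_group M" "root_group N"
    and "\<iota> \<in> mon G M" "isolator M (\<iota> ` carrier G) = carrier M" "f \<in> hom G N"
  obtains F where "F \<in> hom M N"
    "\<And>x y g n. \<lbrakk>x \<in> carrier M; g \<in> carrier G; n \<ge> (1::nat); x [^]\<^bsub>M\<^esub> n = \<iota> g; y \<in> carrier N;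
       y [^]\<^bsub>N\<^esub> n = f g\<rbrakk> \<Longrightarrow> F x = y"
    "\<And>x g n. \<lbrakk>x \<in> carrier M; g \<in> carrier G; n \<ge> (1::nat); x [^]\<^bsub>M\<^esub> n = \<iota> g\<rbrakk> \<Longrightarrow> F x [^]\<^bsub>N\<^esub> n = f g"
proof -
  interpret G: two_step_group G by fact
  interpret M: root_group M by fact
  interpret N: root_group N by fact
  interpret i: group_hom G M \<iota>
    using assms(4) by (simp add: group_hom_def group_hom_axioms_def G.is_group M.is_group mon_def)
  interpret f: group_hom G N f
    using assms(6) by (simp add: group_hom_def group_hom_axioms_def G.is_group N.is_group)
  interpret MK: two_step_subgroup M "\<iota> ` carrier G"
    by (rule hom_image_two_step[OF assms(1,2) i.homh])
  interpret NK: two_step_subgroup N "f ` carrier G"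
    by (rule hom_image_two_step[OF assms(1,3) f.homh])
  have inj: "a = b" if "a \<in> carrier G" "b \<in> carrier G" "\<iota> a = \<iota> b" for a b
    using assms(4) that by (auto simp: mon_def dest: inj_onD)
  define R where "R x y \<longleftrightarrow> y \<in> carrier N \<and> (\<exists>n\<ge>1. \<exists>g\<in>carrier G. x [^]\<^bsub>M\<^esub> (n::nat) = \<iota> g \<and> y [^]\<^bsub>N\<^esub> n = f g)"
    for x y
  define F where "F x = (THE y. R x y)" for x
  have uniq: "y = y'" if x: "x \<in> carrier M" and "R x y" "R x y'" for x y y'
  proof -
    from that obtain n m :: nat and g h where
      y: "y \<in> carrier N" "n \<ge> 1" "g \<in> carrier G" "x [^]\<^bsub>M\<^esub> n = \<iota> g" "y [^]\<^bsub>N\<^esub> n = f g" and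
      y': "y' \<in> carrier N" "m \<ge> 1" "h \<in> carrier G" "x [^]\<^bsub>M\<^esub> m = \<iota> h" "y' [^]\<^bsub>N\<^esub> m = f h"
      unfolding R_def by blast
    have "\<iota> (g [^]\<^bsub>G\<^esub> m) = (x [^]\<^bsub>M\<^esub> n) [^]\<^bsub>M\<^esub> m" by (simp add: i.hom_nat_pow y(3,4))
    also have "\<dots> = (x [^]\<^bsub>M\<^esub> m) [^]\<^bsub>M\<^esub> n" by (simp only: M.nat_pow_pow[OF x] mult.commute)
    also have "\<dots> = \<iota> (h [^]\<^bsub>G\<^esub> n)" by (simp add: i.hom_nat_pow y'(3,4))
    finally have gh: "g [^]\<^bsub>G\<^esub> m = h [^]\<^bsub>G\<^esub> n" using inj y(3) y'(3) by simp
    have "y [^]\<^bsub>N\<^esub> (n * m) = f (g [^]\<^bsub>G\<^esub> m)"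
      by (simp only: N.nat_pow_pow[OF y(1), symmetric] y(5) f.hom_nat_pow[OF y(3)])
    also have "\<dots> = y' [^]\<^bsub>N\<^esub> (m * n)"
      by (simp only: gh N.nat_pow_pow[OF y'(1), symmetric] y'(5) f.hom_nat_pow[OF y'(3)])
    finally show ?thesis
      using N.root_unique[OF y(1) y'(1), of "n * m"] y(2) y'(2) by (simp add: mult.commute)
  qed
  have F_eq: "F x = y" if "x \<in> carrier M" "R x y" for x y
    unfolding F_def using that uniq by (intro the_equality) auto
  have RI: "R x y" if "y \<in> carrier N" "n \<ge> (1::nat)" "g \<in> carrier G" "x [^]\<^bsub>M\<^esub> n = \<iota> g" "y [^]\<^bsub>N\<^esub> n = f g"
    for x y n g using that unfolding R_def by blast
  have F_pow: "F x \<in> carrier N \<and> F x [^]\<^bsub>N\<^esub> n = f g"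
    if x: "x \<in> carrier M" "n \<ge> (1::nat)" "g \<in> carrier G" "x [^]\<^bsub>M\<^esub> n = \<iota> g" for x n g
  proof -
    have "f g \<in> carrier N" using x(3) by simp
    then obtain y where "y \<in> carrier N" "y [^]\<^bsub>N\<^esub> n = f g"
      using N.root_exists x(2) by blast
    then show ?thesis using F_eq[OF x(1) RI[OF _ x(2-4)]] by simp
  qed
  have root: "\<exists>n g. n \<ge> (1::nat) \<and> g \<in> carrier G \<and> x [^]\<^bsub>M\<^esub> n = \<iota> g" if "x \<in> carrier M" for x
  proof -
    have "x \<in> isolator M (\<iota> ` carrier G)" using that assms(5) by simp
    then show ?thesis unfolding isolator_def by blast
  qed
  have "F \<in> hom M N"
  proof (rule homI)
    show "F x \<in> carrier N" if "x \<in> carrier M" for x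
      using F_pow that root by blast
    fix x y assume x: "x \<in> carrier M" and y: "y \<in> carrier M"
    then obtain n :: nat where n: "n \<ge> 1" "x [^]\<^bsub>M\<^esub> n \<in> \<iota> ` carrier G" "y [^]\<^bsub>M\<^esub> n \<in> \<iota> ` carrier G"
      using M.isolator_common_exponent[OF MK.subgroup_axioms] assms(5) by metis
    then obtain g h where gh: "g \<in> carrier G" "h \<in> carrier G" "x [^]\<^bsub>M\<^esub> n = \<iota> g" "y [^]\<^bsub>M\<^esub> n = \<iota> h"
      by auto
    have Fx: "F x \<in> carrier N" "F x [^]\<^bsub>N\<^esub> n = f g" and Fy: "F y \<in> carrier N" "F y [^]\<^bsub>N\<^esub> n = f h"
      using F_pow[OF x n(1) gh(1,3)] F_pow[OF y n(1) gh(2,4)] by auto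
    \<comment> \<open>The word of \<open>mult_pow_in\<close>, written in \<open>G\<close>:
      \<open>\<iota>\<close> and \<open>f\<close> carry it to the same power of the two products,
      which are therefore related by \<open>R\<close>.\<close>
    let ?k = "g [^]\<^bsub>G\<^esub> (2 * n) \<otimes>\<^bsub>G\<^esub> h [^]\<^bsub>G\<^esub> (2 * n) \<otimes>\<^bsub>G\<^esub> inv\<^bsub>G\<^esub> (commutator G g h [^]\<^bsub>G\<^esub> (2 * n * n - 1))"
    have "(x \<otimes>\<^bsub>M\<^esub> y) [^]\<^bsub>M\<^esub> (2 * n * n) = \<iota> ?k"
      using MK.mult_pow_in[OF x y n] gh by (simp add: i.hom_nat_pow i.hom_commutator)
    moreover have "(F x \<otimes>\<^bsub>N\<^esub> F y) [^]\<^bsub>N\<^esub> (2 * n * n) = f ?k"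
      using NK.mult_pow_in[OF Fx(1) Fy(1) n(1)] gh Fx(2) Fy(2)
      by (simp add: f.hom_nat_pow f.hom_commutator)
    moreover have "2 * n * n \<ge> 1" using n(1) by simp
    ultimately show "F (x \<otimes>\<^bsub>M\<^esub> y) = F x \<otimes>\<^bsub>N\<^esub> F y"
      using x y gh(1,2) Fx(1) Fy(1) by (intro F_eq RI[of _ "2 * n * n" ?k]) auto
  qed
  then show ?thesis
  proof (rule that[of F])
    fix x g and n :: nat
    assume x: "x \<in> carrier M" "g \<in> carrier G" "n \<ge> 1" "x [^]\<^bsub>M\<^esub> n = \<iota> g"
    show "F x [^]\<^bsub>N\<^esub> n = f g" using F_pow[OF x(1,3,2,4)] by simp
    fix y assume "y \<in> carrier N" "y [^]\<^bsub>N\<^esub> n = f g"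
    then show "F x = y" using F_eq[OF x(1) RI[OF _ x(3,2,4)]] by simp
  qed
qed

text \<open>Uniqueness of the completion. A kernel element of the extension has a power coming from
  the kernel of \<open>f\<close>; every element of \<open>N\<close> is a root of some
  \<open>f g\<close>, and the root of \<open>\<iota> g\<close> is its preimage.\<close>

lemma completion_iso:
  assumes "two_step_group G" "root_group M" "root_group N"
    and "\<iota> \<in> mon G M" "isolator M (\<iota> ` carrier G) = carrier M"
    and "f \<in> mon G N" "isolator N (f ` carrier G) = carrier N"
  shows "M \<cong> N"
proof -
  interpret G: two_step_group G by fact
  interpret M: root_group M by fact
  interpret N: root_group N by fact
  have f: "f \<in> hom G N" "inj_on f (carrier G)" and i: "\<iota> \<in> hom G M" using assms by (auto simp: mon_def)
  obtain F where F: "F \<in> hom M N"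
    and F_eq: "\<And>x y g n. \<lbrakk>x \<in> carrier M; g \<in> carrier G; n \<ge> (1::nat); x [^]\<^bsub>M\<^esub> n = \<iota> g; y \<in> carrier N;
       y [^]\<^bsub>N\<^esub> n = f g\<rbrakk> \<Longrightarrow> F x = y"
    and F_pow: "\<And>x g n. \<lbrakk>x \<in> carrier M; g \<in> carrier G; n \<ge> (1::nat); x [^]\<^bsub>M\<^esub> n = \<iota> g\<rbrakk> \<Longrightarrow> F x [^]\<^bsub>N\<^esub> n = f g"
    by (rule hom_extends_to_roots[OF assms(1-5) f(1)]) (rule that)
  interpret F: group_hom M N F
    using F by (simp add: group_hom_def group_hom_axioms_def M.is_group N.is_group)
  have f1: "f \<one>\<^bsub>G\<^esub> = \<one>\<^bsub>N\<^esub>" by (rule hom_one[OF f(1) G.is_group N.is_group])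
  have i1: "\<iota> \<one>\<^bsub>G\<^esub> = \<one>\<^bsub>M\<^esub>" by (rule hom_one[OF i G.is_group M.is_group])
  have "x = \<one>\<^bsub>M\<^esub>" if x: "x \<in> carrier M" "F x = \<one>\<^bsub>N\<^esub>" for x
  proof -
    have "x \<in> isolator M (\<iota> ` carrier G)" using x assms(5) by simp
    then obtain n :: nat and g where g: "n \<ge> 1" "g \<in> carrier G" "x [^]\<^bsub>M\<^esub> n = \<iota> g"
      unfolding isolator_def by blast
    have "f g = \<one>\<^bsub>N\<^esub>" using F_pow[OF x(1) g(2,1,3)] x(2) by simp
    then have "g = \<one>\<^bsub>G\<^esub>" using f1 inj_onD[OF f(2)] g(2) by simp
    then show ?thesis using M.pow_eq_one[OF x(1) g(1)] g(3) i1 by simp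
  qed
  then have "inj_on F (carrier M)" by (intro F.inj_on_one_iff[THEN iffD2]) auto
  moreover have "y \<in> F ` carrier M" if y: "y \<in> carrier N" for y
  proof -
    have "y \<in> isolator N (f ` carrier G)" using y assms(7) by simp
    then obtain n :: nat and g where g: "n \<ge> 1" "g \<in> carrier G" "y [^]\<^bsub>N\<^esub> n = f g"
      unfolding isolator_def by blast
    have "\<iota> g \<in> carrier M" using g(2) i by (auto simp: hom_def)
    then obtain x where "x \<in> carrier M" "x [^]\<^bsub>M\<^esub> n = \<iota> g" using M.root_exists g(1) by blast
    then show ?thesis using F_eq[OF _ g(2,1) _ y g(3)] by blast
  qed
  ultimately have "bij_betw F (carrier M) (carrier N)" unfolding bij_betw_def by auto
  then show ?thesis using F by (intro is_isoI isoI)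
qed


section \<open>Retractions onto the centre and dilations\<close>

lemma (in group) finite_common_exponent:
  assumes "subgroup K G" "finite F" "F \<subseteq> isolator G K"
  shows "\<exists>n::nat. n \<ge> 1 \<and> (\<forall>x\<in>F. x [^] n \<in> K)"
  using assms(2,3)
proof (induction F rule: finite_induct)
  case empty
  then show ?case by (intro exI[of _ 1]) simp
next
  case (insert a F)
  have K: "b [^] (k::nat) \<in> K" if "b \<in> K" for b k
    using subgroup_int_pow_closed[OF assms(1) that, of "int k"] by (simp add: int_pow_int)
  obtain n :: nat where n: "n \<ge> 1" "\<And>x. x \<in> F \<Longrightarrow> x [^] n \<in> K" using insert by auto
  obtain m :: nat where m: "m \<ge> 1" "a [^] m \<in> K" "a \<in> carrier G"
    using insert.prems by (auto simp: isolator_def)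
  have "x [^] (n * m) \<in> K" if "x \<in> F" for x
  proof -
    have "x \<in> carrier G" using insert.prems that by (auto simp: isolator_def)
    then show ?thesis using K[OF n(2)[OF that], of m] by (simp only: nat_pow_pow)
  qed
  moreover have "a [^] (n * m) \<in> K"
    using K[OF m(2), of n] by (simp only: nat_pow_pow[OF m(3)] mult.commute)
  moreover have "n * m \<ge> 1" using n(1) m(1) by simp
  ultimately show ?case by blast
qed

text \<open>In Lie ring terms \<open>\<kappa>\<close> is twice an additive retraction onto the centre; the factor two
  avoids square roots of commutators, and the commutator term turns the Lie ring sum into the
  group product.\<close>

definition center_retraction :: "('a, 'm) monoid_scheme \<Rightarrow> 'a set \<Rightarrow> ('a \<Rightarrow> 'a) \<Rightarrow> bool" where
  "center_retraction G B \<kappa> \<longleftrightarrow>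
     subgroup B G \<and> group_center G \<subseteq> B \<and> \<kappa> \<in> B \<rightarrow> group_center G \<and>
     (\<forall>x\<in>B. \<forall>y\<in>B. \<kappa> (x \<otimes>\<^bsub>G\<^esub> y) = \<kappa> x \<otimes>\<^bsub>G\<^esub> \<kappa> y \<otimes>\<^bsub>G\<^esub> commutator G x y) \<and>
     (\<forall>z\<in>group_center G. \<kappa> z = z [^]\<^bsub>G\<^esub> (2::nat))"

context two_step_group
begin

lemma center_retractionD:
  assumes "center_retraction G B \<kappa>"
  shows "subgroup B G" "group_center G \<subseteq> B" "x \<in> B \<Longrightarrow> \<kappa> x \<in> group_center G"
    "x \<in> B \<Longrightarrow> y \<in> B \<Longrightarrow> \<kappa> (x \<otimes> y) = \<kappa> x \<otimes> \<kappa> y \<otimes> commutator G x y"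
    "z \<in> group_center G \<Longrightarrow> \<kappa> z = z [^] (2::nat)"
  using assms by (auto simp: center_retraction_def)

lemma commutator_center [simp]:
  assumes "z \<in> group_center G" "x \<in> carrier G"
  shows "commutator G z x = \<one>" "commutator G x z = \<one>"
  using assms in_centerD[OF assms(1)] by (simp_all only: commutator_eq_one_iff)

lemma commutator_self [simp]: "x \<in> carrier G \<Longrightarrow> commutator G x x = \<one>"
  by (simp only: commutator_eq_one_iff)

lemma center_retraction_center: "center_retraction G (group_center G) (\<lambda>z. z [^] (2::nat))"
proof -
  have "(x \<otimes> y) [^] (2::nat) = x [^] (2::nat) \<otimes> y [^] (2::nat) \<otimes> commutator G x y"
    if "x \<in> group_center G" "y \<in> group_center G" for x y
  proof -
    have xy: "x \<in> carrier G" "y \<in> carrier G" using that by (auto dest: in_centerD(1))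
    have "(x \<otimes> y) [^] (2::nat) = x [^] (2::nat) \<otimes> y [^] (2::nat)"
      by (rule pow_mult_distrib[OF center_mult_commute[OF that(1) xy(2)] xy])
    then show ?thesis using that xy by simp
  qed
  then show ?thesis using subgroup_center by (simp add: center_retraction_def)
qed

text \<open>Powers of one element commute, so the commutator term vanishes and
  \<open>\<kappa>\<close> is a homomorphism on cyclic subgroups of \<open>B\<close>.\<close>

lemma center_retraction_int_pow:
  assumes "center_retraction G B \<kappa>" "x \<in> B"
  shows "\<kappa> (x [^] (k::int)) = \<kappa> x [^] k"
proof -
  note D = center_retractionD[OF assms(1)]
  interpret B: subgroup B G by (rule D(1))
  have X: "x \<in> carrier G" "\<kappa> x \<in> carrier G" using assms(2) in_centerD(1)[OF D(3)[OF assms(2)]] by auto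
  have B: "x [^] (k::int) \<in> B" for k using assms(2) by (rule subgroup_int_pow_closed[OF D(1)])
  have c: "commutator G (x [^] (k::int)) (x [^] (l::int)) = \<one>" for k l
    using X by (simp add: commutator_int_pow_left commutator_int_pow_right)
  have one: "\<kappa> \<one> = \<one>" using D(5)[of \<one>] by simp
  have nat: "\<kappa> (x [^] n) = \<kappa> x [^] n" for n :: nat
  proof (induction n)
    case (Suc n)
    have "\<kappa> (x [^] n \<otimes> x) = \<kappa> (x [^] n) \<otimes> \<kappa> x \<otimes> commutator G (x [^] n) x"
      using D(4) B[of "int n"] assms(2) by (simp add: int_pow_int)
    then show ?case using Suc X by (simp add: commutator_nat_pow_left)
  qed (simp add: one)
  show ?thesis
  proof (cases k rule: int_cases2)
    case (nonneg n)
    then show ?thesis using nat by (simp add: int_pow_int)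
  next
    case (nonpos n)
    let ?u = "x [^] (- int n)" and ?v = "x [^] (int n)"
    have uv: "\<kappa> ?u \<in> carrier G" "\<kappa> ?v \<in> carrier G" using in_centerD(1)[OF D(3)[OF B]] by blast+
    have "\<kappa> (?u \<otimes> ?v) = \<kappa> ?u \<otimes> \<kappa> ?v"
      using D(4)[OF B B] c uv by simp
    moreover have "?u \<otimes> ?v = \<one>" using X int_pow_mult[OF X(1), of "- int n" "int n"] by simp
    ultimately have "\<kappa> ?u \<otimes> \<kappa> ?v = \<one>" using one by (simp only:)
    then have "\<kappa> ?u = inv (\<kappa> ?v)" using inv_equality[OF _ uv(2,1)] by (simp only:)
    then show ?thesis unfolding nonpos int_pow_neg_int[OF X(2)] by (simp only: int_pow_int nat)
  qed
qed

text \<open>Sorting in the commutative group \<open>group_center G\<close>. The letters are the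
  central factors met when a retraction is extended by \<open>g\<close>; the one relation
  \<open>U \<otimes> Q = \<one>\<close> stands for \<open>[g,y]^a [y,g]^a = 1\<close>.\<close>

lemma center_rearrange:
  assumes "{k, l, s, A, B, P, R, Q, T, U} \<subseteq> group_center G" "U \<otimes> Q = \<one>"
  shows "(U \<otimes> U \<otimes> (k \<otimes> l \<otimes> s)) \<otimes> (A \<otimes> B) \<otimes> (P \<otimes> R \<otimes> (Q \<otimes> T))
    = (k \<otimes> A \<otimes> P) \<otimes> (l \<otimes> B \<otimes> T) \<otimes> (s \<otimes> R \<otimes> U)"
proof -
  interpret Z: comm_group "G\<lparr>carrier := group_center G\<rparr>"
  proof (intro group.group_comm_groupI subgroup.subgroup_is_group subgroup_center is_group)
    fix x y assume "x \<in> carrier (G\<lparr>carrier := group_center G\<rparr>)" "y \<in> carrier (G\<lparr>carrier := group_center G\<rparr>)"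
    then show "x \<otimes>\<^bsub>G\<lparr>carrier := group_center G\<rparr>\<^esub> y = y \<otimes>\<^bsub>G\<lparr>carrier := group_center G\<rparr>\<^esub> x"
      using center_mult_commute[OF _ in_centerD(1), of x y] by simp
  qed
  note ac = Z.m_ac[simplified]
  have "(U \<otimes> U \<otimes> (k \<otimes> l \<otimes> s)) \<otimes> (A \<otimes> B) \<otimes> (P \<otimes> R \<otimes> (Q \<otimes> T))
    = (U \<otimes> Q) \<otimes> ((k \<otimes> A \<otimes> P) \<otimes> (l \<otimes> B \<otimes> T) \<otimes> (s \<otimes> R \<otimes> U))"
    using assms(1) by (simp add: ac)
  moreover have "(k \<otimes> A \<otimes> P) \<otimes> (l \<otimes> B \<otimes> T) \<otimes> (s \<otimes> R \<otimes> U) \<in> group_center G"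
    using assms(1) by simp
  ultimately show ?thesis using assms(2) in_centerD(1) by fastforce
qed

end

locale rational_two_step_group = root_group + two_step_group
begin

lemma root_in_center:
  assumes "x \<in> carrier G" "n \<ge> (1::nat)" "x [^] n \<in> group_center G"
  shows "x \<in> group_center G"
  using commute_of_pow[OF assms(1) _ assms(2)] center_mult_commute[OF assms(3)] assms(1)
  by (simp add: group_center_def)

text \<open>A value of \<open>\<kappa>\<close> at \<open>g\<close> is dictated by any power of \<open>g\<close> in \<open>B\<close>; unique roots make it exist
  and independent of that power.\<close>

lemma center_retraction_new_value:
  assumes "center_retraction G B \<kappa>" "g \<in> carrier G"
  shows "\<exists>\<mu>\<in>group_center G. \<forall>a::int. g [^] a \<in> B \<longrightarrow> \<kappa> (g [^] a) = \<mu> [^] a"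
proof (cases "\<exists>m::nat. m \<ge> 1 \<and> g [^] m \<in> B")
  case True
  note D = center_retractionD[OF assms(1)]
  from True obtain m :: nat where m: "m \<ge> 1" "g [^] m \<in> B" by auto
  have km: "\<kappa> (g [^] m) \<in> group_center G" using D(3) m(2) by simp
  obtain \<mu> where \<mu>: "\<mu> \<in> carrier G" "\<mu> [^] m = \<kappa> (g [^] m)"
    using root_exists[OF in_centerD(1)[OF km] m(1)] .
  have \<mu>Z: "\<mu> \<in> group_center G" using root_in_center[OF \<mu>(1) m(1)] \<mu>(2) km by simp
  have "\<kappa> (g [^] a) = \<mu> [^] a" if a: "g [^] a \<in> B" for a :: int
  proof (rule root_unique[OF _ _ m(1)])
    show "\<kappa> (g [^] a) \<in> carrier G" using D(3)[OF a] by (rule in_centerD(1))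
    show "\<mu> [^] a \<in> carrier G" using \<mu>(1) by simp
    have "\<kappa> (g [^] a) [^] int m = \<kappa> ((g [^] a) [^] int m)"
      using center_retraction_int_pow[OF assms(1) a] by simp
    also have "(g [^] a) [^] int m = (g [^] int m) [^] a"
      using assms(2) by (simp only: int_pow_pow mult.commute)
    also have "\<kappa> \<dots> = \<kappa> (g [^] int m) [^] a"
      using center_retraction_int_pow[OF assms(1), of "g [^] int m"] m(2) by (simp add: int_pow_int)
    also have "\<dots> = (\<mu> [^] int m) [^] a" using \<mu>(2) by (simp add: int_pow_int)
    also have "\<dots> = (\<mu> [^] a) [^] int m" using \<mu>(1) by (simp only: int_pow_pow mult.commute)
    finally show "\<kappa> (g [^] a) [^] m = (\<mu> [^] a) [^] m" by (simp only: int_pow_int)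
  qed
  then show ?thesis using \<mu>Z by blast
next
  case False
  note D = center_retractionD[OF assms(1)]
  interpret B: subgroup B G by (rule D(1))
  \<comment> \<open>The only constraint on \<open>\<mu>\<close> is now the trivial one at
    \<open>a = 0\<close>, so \<open>\<one>\<close> serves as a default.\<close>
  have "a = 0" if a: "g [^] a \<in> B" for a :: int
  proof (cases a rule: int_cases2)
    case (nonneg n)
    then have "g [^] n \<in> B" using a by (simp add: int_pow_int)
    then show ?thesis using False nonneg by (cases n) auto
  next
    case (nonpos n)
    then have "inv (g [^] a) = g [^] n" using assms(2) by (simp add: int_pow_neg_int)
    then have "g [^] n \<in> B" using B.m_inv_closed[OF a] by simp
    then show ?thesis using False nonpos by (cases n) auto
  qed
  moreover have "\<kappa> \<one> = \<one>" using D(5)[of \<one>] by simp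
  ultimately have "\<kappa> (g [^] a) = \<one> [^] a" if "g [^] a \<in> B" for a :: int
    using that by (metis int_pow_0)
  then show ?thesis by (intro bexI[of _ \<one>]) auto
qed

text \<open>Once \<open>\<mu>\<close> is the value at \<open>g\<close>, the functional equation
  forces \<open>V x a\<close> as the value at \<open>x \<otimes> g [^] a\<close>, because
  \<open>[x, g^a] = [x,g]^a\<close>. It remains to see that this is well defined and satisfies the
  equation.\<close>

lemma center_retraction_extend:
  assumes "center_retraction G B \<kappa>" "g \<in> carrier G"
  shows "\<exists>B' \<kappa>'. center_retraction G B' \<kappa>' \<and> B \<subseteq> B' \<and> g \<in> B'"
proof -
  note D = center_retractionD[OF assms(1)]
  interpret B: subgroup B G by (rule D(1))
  note g = assms(2)
  obtain \<mu> where \<mu>: "\<mu> \<in> group_center G" "\<And>a::int. g [^] a \<in> B \<Longrightarrow> \<kappa> (g [^] a) = \<mu> [^] a"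
    using center_retraction_new_value[OF assms] by blast
  have \<mu>c: "\<mu> \<in> carrier G" using \<mu>(1) by (rule in_centerD(1))
  have \<kappa>c: "\<kappa> x \<in> carrier G" if "x \<in> B" for x using D(3)[OF that] by (rule in_centerD(1))
  define V where "V x a = \<kappa> x \<otimes> \<mu> [^] a \<otimes> commutator G x g [^] a" for x and a :: int
  define B' where "B' = {x \<otimes> g [^] a | x a. x \<in> B \<and> (a::int) \<in> UNIV}"
  define \<kappa>' where "\<kappa>' u = (THE v. \<exists>x\<in>B. \<exists>a. u = x \<otimes> g [^] a \<and> v = V x a)" for u
  have VZ: "V x a \<in> group_center G" if "x \<in> B" for x a
    unfolding V_def using that D(3) \<mu>(1) commutator_central g by simp
  \<comment> \<open>Two representations differ by a power of \<open>g\<close> lying in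
    \<open>B\<close>, where \<open>\<mu>\<close> agrees with \<open>\<kappa>\<close>; such a power
    does not change the commutator with \<open>g\<close>.\<close>
  have well: "V x a = V y b" if x: "x \<in> B" and y: "y \<in> B" and eq: "x \<otimes> g [^] a = y \<otimes> g [^] b" for x y a b
  proof -
    have "inv x \<otimes> y = g [^] (a - b)"
    proof -
      have "y = y \<otimes> g [^] b \<otimes> g [^] (- b)"
        using y g by (simp add: m_assoc int_pow_mult[symmetric])
      also have "\<dots> = x \<otimes> (g [^] a \<otimes> g [^] (- b))" using x g by (simp add: eq[symmetric] m_assoc)
      also have "g [^] a \<otimes> g [^] (- b) = g [^] (a - b)" using g by (simp add: int_pow_mult[symmetric])
      finally show ?thesis using x g by (simp add: inv_solve_left')
    qed
    then have c: "g [^] (a - b) \<in> B" and y_eq: "y = x \<otimes> g [^] (a - b)"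
      using B.m_closed[OF B.m_inv_closed[OF x] y] x y g inv_solve_left'[of "g [^] (a - b)" x y] by simp_all
    have "\<kappa> y = \<kappa> x \<otimes> \<mu> [^] (a - b) \<otimes> commutator G x g [^] (a - b)"
      unfolding y_eq using D(4)[OF x c] \<mu>(2)[OF c] x g by (simp add: commutator_int_pow_right)
    moreover have "commutator G y g = commutator G x g"
      unfolding y_eq using x g by (simp add: commutator_mult_left commutator_int_pow_left)
    ultimately have "V y b = \<kappa> x \<otimes> \<mu> [^] (a - b) \<otimes> (commutator G x g [^] (a - b) \<otimes> \<mu> [^] b) \<otimes> commutator G x g [^] b"
      unfolding V_def using \<kappa>c[OF x] \<mu>c x g by (simp add: m_assoc)
    also have "commutator G x g [^] (a - b) \<otimes> \<mu> [^] b = \<mu> [^] b \<otimes> commutator G x g [^] (a - b)"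
      using \<mu>(1) x g by (intro center_mult_commute[symmetric]) auto
    also have "\<kappa> x \<otimes> \<mu> [^] (a - b) \<otimes> \<dots> \<otimes> commutator G x g [^] b
      = \<kappa> x \<otimes> (\<mu> [^] (a - b) \<otimes> \<mu> [^] b) \<otimes> (commutator G x g [^] (a - b) \<otimes> commutator G x g [^] b)"
      using \<kappa>c[OF x] \<mu>c x g by (simp add: m_assoc)
    also have "\<dots> = V x a" unfolding V_def using \<mu>c x g by (simp add: int_pow_mult[symmetric])
    finally show ?thesis by simp
  qed
  have \<kappa>': "\<kappa>' (x \<otimes> g [^] a) = V x a" if "x \<in> B" for x a
    unfolding \<kappa>'_def
  proof (rule the_equality)
    show "\<exists>y\<in>B. \<exists>b. x \<otimes> g [^] a = y \<otimes> g [^] b \<and> V x a = V y b" using that by blast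
    fix v assume "\<exists>y\<in>B. \<exists>b. x \<otimes> g [^] a = y \<otimes> g [^] b \<and> v = V y b"
    then obtain y b where y: "y \<in> B" "x \<otimes> g [^] a = y \<otimes> g [^] b" "v = V y b" by blast
    then show "v = V x a" using well[OF that y(1,2)] by simp
  qed
  \<comment> \<open>Moving \<open>y\<close> to the left past \<open>g [^] a\<close> costs
    \<open>[g,y]^a\<close>, which is central and hence absorbed by \<open>B\<close>.\<close>
  have mult: "(x \<otimes> g [^] a) \<otimes> (y \<otimes> g [^] b) = (commutator G g y [^] a \<otimes> (x \<otimes> y)) \<otimes> g [^] (a + b)"
    and in_B: "commutator G g y [^] a \<otimes> (x \<otimes> y) \<in> B" if x: "x \<in> B" and y: "y \<in> B" for x y and a b :: int
  proof -
    have c: "commutator G g y [^] a \<in> group_center G" using commutator_central[OF g] y by simp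
    have "(x \<otimes> g [^] a) \<otimes> (y \<otimes> g [^] b) = x \<otimes> (g [^] a \<otimes> y) \<otimes> g [^] b"
      using x y g by (simp add: m_assoc)
    also have "g [^] a \<otimes> y = commutator G g y [^] a \<otimes> (y \<otimes> g [^] a)"
      using mult_commutator[of "g [^] a" y] y g by (simp add: commutator_int_pow_left)
    also have "x \<otimes> \<dots> = commutator G g y [^] a \<otimes> (x \<otimes> (y \<otimes> g [^] a))"
      using x y g by (intro center_left_commute[OF c]) auto
    finally show "(x \<otimes> g [^] a) \<otimes> (y \<otimes> g [^] b) = (commutator G g y [^] a \<otimes> (x \<otimes> y)) \<otimes> g [^] (a + b)"
      using x y g in_centerD(1)[OF c] by (simp add: m_assoc int_pow_mult[symmetric])
    show "commutator G g y [^] a \<otimes> (x \<otimes> y) \<in> B" using c D(2) x y by blast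
  qed
  have V_mult: "V (commutator G g y [^] a \<otimes> (x \<otimes> y)) (a + b)
      = V x a \<otimes> V y b \<otimes> commutator G (x \<otimes> g [^] a) (y \<otimes> g [^] b)"
    if x: "x \<in> B" and y: "y \<in> B" for x y and a b :: int
  proof -
    let ?p = "commutator G x g" and ?q = "commutator G y g" and ?u = "commutator G g y"
    have Z: "?p \<in> group_center G" "?q \<in> group_center G" "?u \<in> group_center G"
      "commutator G x y \<in> group_center G"
      using x y g commutator_central by auto
    note C = Z[THEN in_centerD(1)]
    have u: "?u [^] a \<otimes> ?q [^] a = \<one>"
    proof -
      have "?u [^] a = inv (?q [^] a)" using commutator_swap[of y g] y g by (simp add: int_pow_inv)
      then show ?thesis using C by simp
    qed
    have "?u [^] a \<in> B" using Z(3) D(2) by auto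
    \<comment> \<open>Here the factor two in \<open>\<kappa>\<close> is consumed: one copy of
      \<open>[g,y]^a\<close> will cancel \<open>[y,g]^a\<close>, the other is part of the commutator
      on the right.\<close>
    then have "\<kappa> (?u [^] a \<otimes> (x \<otimes> y)) = (?u [^] a) [^] (2::nat) \<otimes> (\<kappa> x \<otimes> \<kappa> y \<otimes> commutator G x y)"
      using D(4)[of "?u [^] a" "x \<otimes> y"] D(4)[OF x y] D(5)[of "?u [^] a"] x y Z C \<kappa>c by simp
    then have 1: "\<kappa> (?u [^] a \<otimes> (x \<otimes> y)) = ?u [^] a \<otimes> ?u [^] a \<otimes> (\<kappa> x \<otimes> \<kappa> y \<otimes> commutator G x y)"
      using C by (simp add: numeral_2_eq_2)
    have "commutator G (?u [^] a \<otimes> (x \<otimes> y)) g = ?p \<otimes> ?q"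
      using x y g C Z by (simp add: commutator_mult_left)
    then have 2: "commutator G (?u [^] a \<otimes> (x \<otimes> y)) g [^] (a + b) = ?p [^] a \<otimes> ?p [^] b \<otimes> (?q [^] a \<otimes> ?q [^] b)"
      using int_pow_mult_distrib[OF center_mult_commute[OF Z(1) C(2)] C(1,2)] C by (simp add: int_pow_mult)
    have "commutator G (x \<otimes> g [^] a) (y \<otimes> g [^] b)
        = (commutator G x y \<otimes> ?u [^] a) \<otimes> ?p [^] b"
      using x y g C by (simp add: commutator_mult_left commutator_mult_right commutator_int_pow_left
          commutator_int_pow_right m_assoc)
    also have "\<dots> = commutator G x y \<otimes> ?p [^] b \<otimes> ?u [^] a"
      using C center_mult_commute[of "?u [^] a" "?p [^] b"] Z by (simp add: m_assoc)
    finally have 3: "commutator G (x \<otimes> g [^] a) (y \<otimes> g [^] b)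
        = commutator G x y \<otimes> ?p [^] b \<otimes> ?u [^] a" .
    show ?thesis
      unfolding V_def 1 2 3 int_pow_mult[OF \<mu>c]
      by (rule center_rearrange) (use D(3)[OF x] D(3)[OF y] \<mu>(1) Z u in auto)
  qed
  have BB': "x \<otimes> g [^] a \<in> B'" if "x \<in> B" for x and a :: int unfolding B'_def using that by blast
  have sub: "B \<subseteq> B'"
  proof
    fix x assume "x \<in> B" then show "x \<in> B'" using BB'[of x 0] by simp
  qed
  have gB: "g \<in> B'" using BB'[of \<one> 1] g by simp
  have "subgroup B' G"
  proof (rule subgroupI)
    show "B' \<subseteq> carrier G" unfolding B'_def using g by auto
    show "B' \<noteq> {}" using gB by auto
    fix u assume "u \<in> B'"
    then obtain x and a :: int where u: "x \<in> B" "u = x \<otimes> g [^] a" unfolding B'_def by blast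
    \<comment> \<open>The inverse as a product of two normal forms, so that \<open>mult\<close>
      applies.\<close>
    have "inv u = (\<one> \<otimes> g [^] (- a)) \<otimes> (inv x \<otimes> g [^] (0::int))"
      using u g by (simp add: inv_mult_group int_pow_neg)
    then show "inv u \<in> B'" using u mult[of \<one> "inv x" "- a" 0] BB'[OF in_B[of \<one> "inv x" "- a"]] by simp
    fix w assume "w \<in> B'"
    then obtain y and b :: int where w: "y \<in> B" "w = y \<otimes> g [^] b" unfolding B'_def by blast
    show "u \<otimes> w \<in> B'" unfolding u(2) w(2) mult[OF u(1) w(1)] by (rule BB'[OF in_B[OF u(1) w(1)]])
  qed
  moreover have "\<kappa>' \<in> B' \<rightarrow> group_center G" using \<kappa>' VZ unfolding B'_def by auto
  moreover have "\<kappa>' (u \<otimes> w) = \<kappa>' u \<otimes> \<kappa>' w \<otimes> commutator G u w" if uw: "u \<in> B'" "w \<in> B'" for u w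
  proof -
    obtain x y and a b :: int where "x \<in> B" "u = x \<otimes> g [^] a" "y \<in> B" "w = y \<otimes> g [^] b"
      using uw unfolding B'_def by blast
    then show ?thesis by (simp only: \<kappa>' mult in_B V_mult)
  qed
  moreover have "\<kappa>' z = z [^] (2::nat)" if "z \<in> group_center G" for z
  proof -
    have "z \<in> B" using that D(2) by blast
    then have "\<kappa>' z = \<kappa> z" using \<kappa>'[of z 0] \<kappa>c by (simp add: V_def)
    then show ?thesis using D(5)[OF that] by simp
  qed
  ultimately have "center_retraction G B' \<kappa>'"
    using sub D(2) unfolding center_retraction_def by blast
  then show ?thesis using sub gB by blast
qed

text \<open>The induction starts from the centre with squaring; \<open>F\<close> will be the image
  of a finite generating set.\<close>

lemma center_retraction_exists:
  assumes "finite F" "F \<subseteq> carrier G"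
  shows "\<exists>B \<kappa>. center_retraction G B \<kappa> \<and> F \<subseteq> B"
  using assms
proof (induction F rule: finite_induct)
  case empty
  then show ?case using center_retraction_center by blast
next
  case (insert g F)
  then obtain B \<kappa> where "center_retraction G B \<kappa>" "F \<subseteq> B" by auto
  with center_retraction_extend[of B \<kappa> g] insert.prems show ?case by blast
qed

end


section \<open>Dilations and embeddings of one lattice into another\<close>

text \<open>In Lie ring terms, with \<open>\<kappa> = 2\<pi>\<close>, the map is
  \<open>N x + N(N-1) \<pi>(x)\<close>: it multiplies by \<open>N\<close> on the kernel of
  \<open>\<pi>\<close> and by \<open>N + N(N-1)\<close>, the square of \<open>N\<close>, on the
  centre. In group terms the power map fails to be multiplicative by
  \<open>[x,y]^(N choose 2)\<close>, and the commutator term of \<open>\<kappa>\<close> supplies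
  exactly this factor.\<close>

lemma (in two_step_group) dilation:
  assumes "center_retraction G B \<kappa>"
  defines "\<delta> \<equiv> \<lambda>N x. x [^] (N::nat) \<otimes> \<kappa> x [^] (N choose 2)"
  shows "x \<in> B \<Longrightarrow> y \<in> B \<Longrightarrow> \<delta> N (x \<otimes> y) = \<delta> N x \<otimes> \<delta> N y"
    and "z \<in> group_center G \<Longrightarrow> \<delta> N z = z [^] (N * N)"
proof -
  note D = center_retractionD[OF assms(1)]
  interpret B: subgroup B G by (rule D(1))
  show "\<delta> N (x \<otimes> y) = \<delta> N x \<otimes> \<delta> N y" if xy: "x \<in> B" "y \<in> B"
  proof -
    let ?C = "N choose 2" and ?d = "commutator G x y"
    have k: "\<kappa> x \<in> group_center G" "\<kappa> y \<in> group_center G" and d: "?d \<in> group_center G"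
      using D(3) xy commutator_central by auto
    note kc = k[THEN in_centerD(1)] and dc = in_centerD(1)[OF d]
    have X: "x \<in> carrier G" "y \<in> carrier G" using xy by auto
    have "(\<kappa> x \<otimes> \<kappa> y \<otimes> ?d) [^] ?C = (\<kappa> x \<otimes> \<kappa> y) [^] ?C \<otimes> ?d [^] ?C"
      by (rule pow_mult_distrib) (use kc dc center_mult_commute[OF d] in simp_all)
    also have "(\<kappa> x \<otimes> \<kappa> y) [^] ?C = \<kappa> x [^] ?C \<otimes> \<kappa> y [^] ?C"
      by (rule pow_mult_distrib[OF center_mult_commute[OF k(1) kc(2)] kc])
    also have "\<dots> \<otimes> ?d [^] ?C = ?d [^] ?C \<otimes> (\<kappa> x [^] ?C \<otimes> \<kappa> y [^] ?C)"
      using d kc by (intro center_mult_commute[symmetric]) auto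
    finally have "\<delta> N (x \<otimes> y) = ((x \<otimes> y) [^] N \<otimes> ?d [^] ?C) \<otimes> (\<kappa> x [^] ?C \<otimes> \<kappa> y [^] ?C)"
      unfolding \<delta>_def D(4)[OF xy] using X kc dc by (simp add: m_assoc)
    also have "(x \<otimes> y) [^] N \<otimes> ?d [^] ?C = x [^] N \<otimes> y [^] N"
      by (rule mult_pow_class2[OF X dc mult_commutator[OF X]])
        (use X d in \<open>auto intro: center_mult_commute\<close>)
    also have "x [^] N \<otimes> y [^] N \<otimes> (\<kappa> x [^] ?C \<otimes> \<kappa> y [^] ?C)
        = x [^] N \<otimes> (y [^] N \<otimes> (\<kappa> x [^] ?C \<otimes> \<kappa> y [^] ?C))"
      using X kc by (simp add: m_assoc)
    also have "y [^] N \<otimes> (\<kappa> x [^] ?C \<otimes> \<kappa> y [^] ?C) = \<kappa> x [^] ?C \<otimes> (y [^] N \<otimes> \<kappa> y [^] ?C)"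
      using X kc k by (intro center_left_commute) auto
    finally show ?thesis unfolding \<delta>_def using X kc by (simp add: m_assoc)
  qed
  show "\<delta> N z = z [^] (N * N)" if z: "z \<in> group_center G"
  proof -
    have "N + 2 * (N choose 2) = N * N" by (cases N) (simp_all add: choose_two)
    then show ?thesis
      unfolding \<delta>_def D(5)[OF z] using in_centerD(1)[OF z] by (simp add: nat_pow_pow nat_pow_mult)
  qed
qed

text \<open>A dilation \<open>x \<mapsto> x\<^sup>N \<kappa>(x)\<^bsup>N(N-1)/2\<^esup>\<close> with \<open>N\<close> sufficiently divisible moves the finitely
  generated lattice \<open>G\<close> into the commensurable lattice \<open>H\<close>.\<close>

lemma embedding_of_common_completion:
  fixes G :: "('a, 'm) monoid_scheme" and H :: "('b, 'n) monoid_scheme" and M :: "('c, 'k) monoid_scheme"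
  assumes "finitely_generated_group G" "group G" "group H" "root_group M" "two_step_group M"
    and \<alpha>: "\<alpha> \<in> mon G M" "isolator M (\<alpha> ` carrier G) = carrier M"
    and \<beta>: "\<beta> \<in> mon H M" "isolator M (\<beta> ` carrier H) = carrier M"
  shows "\<exists>j. j \<in> mon G H"
proof -
  interpret G: group G by fact
  interpret H: group H by fact
  interpret M: rational_two_step_group M
    using assms(4,5) by (simp add: rational_two_step_group_def)
  interpret a: group_hom G M \<alpha>
    using \<alpha>(1) by (simp add: group_hom_def group_hom_axioms_def G.is_group M.is_group mon_def)
  interpret b: group_hom H M \<beta>
    using \<beta>(1) by (simp add: group_hom_def group_hom_axioms_def H.is_group M.is_group mon_def)
  obtain S where S: "finite S" "S \<subseteq> carrier G" "generate G S = carrier G"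
    using assms(1) by (auto simp: finitely_generated_group_def)
  have \<alpha>S: "\<alpha> ` carrier G = generate M (\<alpha> ` S)" using a.generate_img[OF S(2)] S(3) by simp
  obtain B \<kappa> where \<kappa>: "center_retraction M B \<kappa>" and SB: "\<alpha> ` S \<subseteq> B"
    using M.center_retraction_exists[of "\<alpha> ` S"] S a.hom_closed by blast
  note D = M.center_retractionD[OF \<kappa>]
  have B: "\<alpha> g \<in> B" if "g \<in> carrier G" for g
    using M.generate_subgroup_incl[OF SB D(1)] that \<alpha>S by auto
  let ?L = "\<beta> ` carrier H"
  have L: "subgroup ?L M" by (rule b.img_is_subgroup)
  have Lpow: "u [^]\<^bsub>M\<^esub> (k::nat) \<in> ?L" if "u \<in> ?L" for u k
    using M.subgroup_int_pow_closed[OF L that, of "int k"] by (simp add: int_pow_int)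
  have "\<kappa> u \<in> carrier M" if "u \<in> \<alpha> ` S" for u
    using D(3) SB that by (blast intro: in_centerD(1))
  \<comment> \<open>Both the generators and their values under \<open>\<kappa>\<close> occur in
    \<open>f\<close>, so one exponent has to serve both.\<close>
  then have "\<alpha> ` S \<union> \<kappa> ` \<alpha> ` S \<subseteq> isolator M ?L" using \<beta>(2) S(2) by auto
  then obtain n :: nat where n: "n \<ge> 1" "\<And>u. u \<in> \<alpha> ` S \<union> \<kappa> ` \<alpha> ` S \<Longrightarrow> u [^]\<^bsub>M\<^esub> n \<in> ?L"
    using M.finite_common_exponent[OF L, of "\<alpha> ` S \<union> \<kappa> ` \<alpha> ` S"] S(1) by auto
  \<comment> \<open>Doubling makes \<open>N choose 2 = n * (2 * n - 1)\<close> a multiple of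
    \<open>n\<close>.\<close>
  define N where "N = 2 * n"
  define f where "f g = \<alpha> g [^]\<^bsub>M\<^esub> N \<otimes>\<^bsub>M\<^esub> \<kappa> (\<alpha> g) [^]\<^bsub>M\<^esub> (N choose 2)" for g
  have \<kappa>c: "\<kappa> (\<alpha> g) \<in> carrier M" if "g \<in> carrier G" for g
    using D(3)[OF B[OF that]] by (rule in_centerD(1))
  have "f \<in> hom G M"
  proof (rule homI)
    fix g h assume gh: "g \<in> carrier G" "h \<in> carrier G"
    show "f g \<in> carrier M" unfolding f_def using gh(1) \<kappa>c by simp
    show "f (g \<otimes>\<^bsub>G\<^esub> h) = f g \<otimes>\<^bsub>M\<^esub> f h"
      using M.dilation(1)[OF \<kappa> B[OF gh(1)] B[OF gh(2)], of N] gh by (simp add: f_def)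
  qed
  then interpret f: group_hom G M f
    by (simp add: group_hom_def group_hom_axioms_def G.is_group M.is_group)
  have "f s \<in> ?L" if s: "s \<in> S" for s
  proof -
    have "N choose 2 = n * (2 * n - 1)" by (simp add: N_def choose_two)
    moreover have "\<alpha> s \<in> carrier M" "\<kappa> (\<alpha> s) \<in> carrier M" using s S(2) \<kappa>c by auto
    ultimately have "f s = (\<alpha> s [^]\<^bsub>M\<^esub> n) [^]\<^bsub>M\<^esub> (2::nat) \<otimes>\<^bsub>M\<^esub> (\<kappa> (\<alpha> s) [^]\<^bsub>M\<^esub> n) [^]\<^bsub>M\<^esub> (2 * n - 1)"
      unfolding f_def by (simp only: N_def M.nat_pow_pow mult.commute)
    moreover have "\<alpha> s [^]\<^bsub>M\<^esub> n \<in> ?L" "\<kappa> (\<alpha> s) [^]\<^bsub>M\<^esub> n \<in> ?L" using n(2) s by auto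
    ultimately show ?thesis using subgroup.m_closed[OF L Lpow Lpow] by simp
  qed
  then have fS: "f ` S \<subseteq> ?L" by auto
  have fL: "f g \<in> ?L" if "g \<in> carrier G" for g
    using M.generate_subgroup_incl[OF fS L] f.generate_img[OF S(2)] S(3) that by auto
  have inj_f: "g = \<one>\<^bsub>G\<^esub>" if g: "g \<in> carrier G" "f g = \<one>\<^bsub>M\<^esub>" for g
  proof -
    have NN: "N * N \<ge> 1" using n(1) by (simp add: N_def)
    have central: "f h = \<alpha> h [^]\<^bsub>M\<^esub> (N * N)" if "\<alpha> h \<in> group_center M" for h
      using M.dilation(2)[OF \<kappa> that, of N] by (simp add: f_def)
    have comm: "\<alpha> g \<otimes>\<^bsub>M\<^esub> \<alpha> h = \<alpha> h \<otimes>\<^bsub>M\<^esub> \<alpha> g" if h: "h \<in> carrier G" for h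
    proof -
      have ac: "\<alpha> (commutator G g h) = commutator M (\<alpha> g) (\<alpha> h)" using g h by (simp add: a.hom_commutator)
      have "commutator M (\<alpha> g) (\<alpha> h) \<in> group_center M" using g h M.commutator_central by simp
      then have "f (commutator G g h) = commutator M (\<alpha> g) (\<alpha> h) [^]\<^bsub>M\<^esub> (N * N)"
        using central ac by simp
      moreover have "f (commutator G g h) = \<one>\<^bsub>M\<^esub>"
        using g h by (simp add: f.hom_commutator commutator_def)
      ultimately have "commutator M (\<alpha> g) (\<alpha> h) = \<one>\<^bsub>M\<^esub>"
        using M.pow_eq_one[OF _ NN] g h by simp
      then show ?thesis using M.commutator_eq_one_iff g h by simp
    qed
    have "\<alpha> g \<otimes>\<^bsub>M\<^esub> w = w \<otimes>\<^bsub>M\<^esub> \<alpha> g" if w: "w \<in> carrier M" for w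
    proof -
      have "w \<in> isolator M (\<alpha> ` carrier G)" using w \<alpha>(2) by simp
      then obtain m :: nat and h where m: "m \<ge> 1" "h \<in> carrier G" "w [^]\<^bsub>M\<^esub> m = \<alpha> h"
        unfolding isolator_def by blast
      have "w \<otimes>\<^bsub>M\<^esub> \<alpha> g = \<alpha> g \<otimes>\<^bsub>M\<^esub> w"
        by (rule M.commute_of_pow[OF w _ m(1)]) (use comm[OF m(2)] m(3) g in simp_all)
      then show ?thesis by simp
    qed
    then have "\<alpha> g \<in> group_center M" using g(1) by (simp add: group_center_def)
    then have "\<alpha> g [^]\<^bsub>M\<^esub> (N * N) = \<one>\<^bsub>M\<^esub>" using central g(2) by simp
    then have "\<alpha> g = \<alpha> \<one>\<^bsub>G\<^esub>" using M.pow_eq_one[OF _ NN] g(1) by simp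
    moreover have "inj_on \<alpha> (carrier G)" using \<alpha>(1) by (simp add: mon_def)
    ultimately show ?thesis using g(1) by (blast dest: inj_onD)
  qed
  define j where "j g = inv_into (carrier H) \<beta> (f g)" for g
  have j: "j g \<in> carrier H" "\<beta> (j g) = f g" if "g \<in> carrier G" for g
    unfolding j_def using fL[OF that] by (auto intro: inv_into_into f_inv_into_f)
  have \<beta>_inj: "inj_on \<beta> (carrier H)" using \<beta>(1) by (simp add: mon_def)
  have "j \<in> hom G H"
  proof (rule homI)
    show "j g \<in> carrier H" if "g \<in> carrier G" for g using j(1)[OF that] .
    fix g h assume gh: "g \<in> carrier G" "h \<in> carrier G"
    then have "\<beta> (j (g \<otimes>\<^bsub>G\<^esub> h)) = \<beta> (j g \<otimes>\<^bsub>H\<^esub> j h)" using j by simp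
    then show "j (g \<otimes>\<^bsub>G\<^esub> h) = j g \<otimes>\<^bsub>H\<^esub> j h" using inj_onD[OF \<beta>_inj] gh j(1) by simp
  qed
  moreover have "inj_on j (carrier G)"
  proof (rule inj_onI)
    fix g h assume "g \<in> carrier G" "h \<in> carrier G" "j g = j h"
    moreover from this have "f g = f h" using j(2) by metis
    moreover have "inj_on f (carrier G)" using inj_f by (intro f.inj_on_one_iff[THEN iffD2]) auto
    ultimately show "g = h" by (auto dest: inj_onD)
  qed
  ultimately show ?thesis by (auto simp: mon_def)
qed


section \<open>Injective endomorphisms\<close>

lemma (in group) torsion_free_int_pow:
  assumes "torsion_free_group G" "x \<in> carrier G" "x [^] (k::int) = \<one>" "k \<noteq> 0"
  shows "x = \<one>"
proof -
  have "x [^] n = \<one> \<Longrightarrow> n \<ge> 1 \<Longrightarrow> x = \<one>" for n :: nat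
    using assms(1,2) by (auto simp: torsion_free_group_def)
  moreover have "x [^] (nat \<bar>k\<bar>) = \<one>"
  proof (cases k rule: int_cases2)
    case (nonneg n)
    then show ?thesis using assms(3) by (simp add: int_pow_int)
  next
    case (nonpos n)
    then show ?thesis using assms(2,3) by (simp add: int_pow_neg_int)
  qed
  moreover have "nat \<bar>k\<bar> \<ge> 1" using assms(4) by linarith
  ultimately show ?thesis by blast
qed

text \<open>The explicit generator \<open>z\<close> gives central elements integer exponents. The
  last assumption records that the class is exactly two; it yields a nontrivial central commutator
  and thus \<open>z \<noteq> \<one>\<close>.\<close>

locale cyclic_center_group = two_step_group +
  fixes z
  assumes torsion_free: "torsion_free_group G"
    and z_center: "z \<in> group_center G"
    and z_generates: "w \<in> group_center G \<Longrightarrow> \<exists>k::int. w = z [^] k"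
    and noncommutative: "\<exists>x\<in>carrier G. \<exists>y\<in>carrier G. commutator G x y \<noteq> \<one>"
begin

lemma z_closed [simp]: "z \<in> carrier G"
  using z_center by (rule in_centerD(1))

lemma z_neq_one: "z \<noteq> \<one>"
proof
  assume "z = \<one>"
  then have "commutator G x y = \<one>" if "x \<in> carrier G" "y \<in> carrier G" for x y
    using z_generates[OF commutator_central[OF that]] by auto
  then show False using noncommutative by blast
qed

text \<open>As \<open>H\<close> is torsion free, \<open>f z\<close> has infinite order and
  \<open>f\<close> is injective on the centre. For \<open>x\<close> in the kernel every
  \<open>[x,y]\<close> is central and in the kernel, hence trivial, so \<open>x\<close> is central
  too.\<close>

lemma mon_of_z_neq_one:
  assumes "group H" "torsion_free_group H" "f \<in> hom G H" "f z \<noteq> \<one>\<^bsub>H\<^esub>"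
  shows "f \<in> mon G H"
proof -
  interpret H: group H by fact
  interpret f: group_hom G H f
    using assms(3) by (simp add: group_hom_def group_hom_axioms_def is_group H.is_group)
  have central: "w = \<one>" if w: "w \<in> group_center G" "f w = \<one>\<^bsub>H\<^esub>" for w
  proof -
    obtain k :: int where k: "w = z [^] k" using z_generates w(1) by blast
    then have "f z [^]\<^bsub>H\<^esub> k = \<one>\<^bsub>H\<^esub>" using w(2) by (simp add: f.hom_int_pow)
    moreover have "f z \<in> carrier H" by simp
    ultimately have "k = 0" using H.torsion_free_int_pow[OF assms(2)] assms(4) by blast
    then show ?thesis using k by simp
  qed
  have "x = \<one>" if x: "x \<in> carrier G" "f x = \<one>\<^bsub>H\<^esub>" for x
  proof (rule central[OF _ x(2)])
    have "x \<otimes> y = y \<otimes> x" if y: "y \<in> carrier G" for y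
    proof -
      have "f (commutator G x y) = \<one>\<^bsub>H\<^esub>" using x y by (simp add: f.hom_commutator commutator_def)
      then show ?thesis using central commutator_central commutator_eq_one_iff x(1) y by blast
    qed
    then show "x \<in> group_center G" using x(1) by (simp add: group_center_def)
  qed
  then have "inj_on f (carrier G)" by (intro f.inj_on_one_iff[THEN iffD2]) auto
  then show ?thesis using assms(3) by (simp add: mon_def)
qed

text \<open>\<open>[x,y]^k = [x^k,y]\<close> is trivial, and there is no torsion.\<close>

lemma center_of_int_pow:
  assumes "x \<in> carrier G" "x [^] (k::int) \<in> group_center G" "k \<noteq> 0"
  shows "x \<in> group_center G"
proof -
  have "x \<otimes> y = y \<otimes> x" if y: "y \<in> carrier G" for y
  proof -
    have "commutator G x y [^] k = \<one>"
      using commutator_int_pow_left[OF assms(1) y, of k] commutator_center(1)[OF assms(2) y] by simp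
    then have "commutator G x y = \<one>"
      using torsion_free_int_pow[OF torsion_free _ _ assms(3)] assms(1) y by simp
    then show ?thesis using commutator_eq_one_iff assms(1) y by simp
  qed
  then show ?thesis using assms(1) by (simp add: group_center_def)
qed

end

text \<open>The product of the \<open>\<theta>^i(x)^(c i)\<close> for \<open>i < n\<close> in
  increasing order, nested as in Horner's scheme so that a vanishing leading coefficient leaves a
  value of \<open>\<theta>\<close>.\<close>

primrec orbit_product ::
    "('a, 'm) monoid_scheme \<Rightarrow> ('a \<Rightarrow> 'a) \<Rightarrow> 'a \<Rightarrow> nat \<Rightarrow> (nat \<Rightarrow> int) \<Rightarrow> 'a" where
  "orbit_product G \<theta> x 0 c = \<one>\<^bsub>G\<^esub>"
| "orbit_product G \<theta> x (Suc n) c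
    = x [^]\<^bsub>G\<^esub> c 0 \<otimes>\<^bsub>G\<^esub> \<theta> (orbit_product G \<theta> x n (\<lambda>i. c (Suc i)))"

text \<open>Commutators with a finite generating set embed \<open>G / Z(G)\<close> into some \<open>\<int>\<^sup>n\<close>, so the orbit of
  \<open>x\<close> under an injective \<open>\<theta>\<close> is linearly dependent modulo the centre; cancelling powers of \<open>\<theta>\<close>
  makes the coefficient of \<open>x\<close> nonzero.\<close>

lemma (in cyclic_center_group) isolator_injective_endomorphism:
  assumes "finitely_generated_group G" "\<theta> \<in> mon G G"
  shows "isolator G (\<theta> ` carrier G) = carrier G"
proof
  show "isolator G (\<theta> ` carrier G) \<subseteq> carrier G" by (auto simp: isolator_def)
  obtain S where S: "finite S" "S \<subseteq> carrier G" "generate G S = carrier G"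
    using assms(1) by (auto simp: finitely_generated_group_def)
  have \<theta>_inj: "inj_on \<theta> (carrier G)" using assms(2) by (simp add: mon_def)
  interpret \<theta>: group_hom G G \<theta>
    using assms(2) by (simp add: group_hom_def group_hom_axioms_def is_group mon_def)
  have reflect: "u \<in> group_center G" if u: "u \<in> carrier G" "\<theta> u \<in> group_center G" for u
  proof -
    have "u \<otimes> y = y \<otimes> u" if y: "y \<in> carrier G" for y
    proof -
      have "\<theta> (u \<otimes> y) = \<theta> (y \<otimes> u)" using u y in_centerD(2)[OF u(2), of "\<theta> y"] by simp
      then show ?thesis using inj_onD[OF \<theta>_inj] u(1) y by simp
    qed
    then show ?thesis using u(1) by (simp add: group_center_def)
  qed
  \<comment> \<open>Although \<open>\<theta>\<close> need not be surjective it preserves the centre: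
    a nonzero power of \<open>z\<close> is a commutator, so a nonzero power of
    \<open>\<theta> z\<close> is one as well.\<close>
  have \<theta>z: "\<theta> z \<in> group_center G"
  proof -
    obtain a b where ab: "a \<in> carrier G" "b \<in> carrier G" "commutator G a b \<noteq> \<one>"
      using noncommutative by blast
    obtain k :: int where k: "commutator G a b = z [^] k"
      using z_generates[OF commutator_central[OF ab(1,2)]] by blast
    then have k0: "k \<noteq> 0" using ab(3) by auto
    have "\<theta> z [^] k = commutator G (\<theta> a) (\<theta> b)"
      unfolding \<theta>.hom_commutator[OF ab(1,2), symmetric] k by (simp add: \<theta>.hom_int_pow)
    moreover have "commutator G (\<theta> a) (\<theta> b) \<in> group_center G" using ab by (intro commutator_central) auto
    ultimately show ?thesis using k0 by (intro center_of_int_pow[of "\<theta> z" k]) simp_all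
  qed
  then obtain l :: int where l: "\<theta> z = z [^] l" using z_generates by blast
  have "\<theta> z \<noteq> \<one>"
  proof
    assume "\<theta> z = \<one>"
    then have "\<theta> z = \<theta> \<one>" by simp
    then show False using inj_onD[OF \<theta>_inj] z_neq_one by simp
  qed
  then have l0: "l \<noteq> 0" using l by auto
  \<comment> \<open>The coordinates of \<open>x\<close> modulo the centre. The exponent is unique
    since \<open>z\<close> has infinite order, which makes \<open>E\<close> additive in
    \<open>x\<close>.\<close>
  define E where "E x s = (SOME k::int. commutator G x s = z [^] k)" for x s
  have E: "commutator G x s = z [^] E x s" if "x \<in> carrier G" "s \<in> carrier G" for x s
    unfolding E_def using z_generates[OF commutator_central[OF that]] by (rule someI_ex)
  have E_eq: "E x s = k" if "x \<in> carrier G" "s \<in> carrier G" "commutator G x s = z [^] k" for x s k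
  proof (rule ccontr)
    assume "E x s \<noteq> k"
    then have "E x s - k \<noteq> 0" by simp
    moreover have "z [^] (E x s - k) = \<one>" using E[OF that(1,2)] that(3) by (simp add: int_pow_diff)
    ultimately show False using torsion_free_int_pow[OF torsion_free z_closed] z_neq_one by blast
  qed
  have E_mult: "E (x \<otimes> y) s = E x s + E y s" if "x \<in> carrier G" "y \<in> carrier G" "s \<in> carrier G" for x y s
    using that by (intro E_eq) (simp_all add: commutator_mult_left int_pow_mult E[symmetric])
  have E_pow: "E (x [^] k) s = k * E x s" if "x \<in> carrier G" "s \<in> carrier G" for x s and k :: int
    using that by (intro E_eq)
      (simp_all add: commutator_int_pow_left mult.commute[of k] int_pow_pow[symmetric] E[symmetric])
  have E_one: "E \<one> s = 0" if "s \<in> carrier G" for s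
    using that by (intro E_eq) simp_all
  \<comment> \<open>The centraliser of \<open>x\<close> is a subgroup, so it is enough that it
    contains the generators.\<close>
  have centralI: "x \<in> group_center G" if x: "x \<in> carrier G" and "\<And>s. s \<in> S \<Longrightarrow> E x s = 0" for x
  proof -
    let ?C = "{y \<in> carrier G. commutator G x y = \<one>}"
    have one: "commutator G x \<one> = \<one>" using x by simp
    have "subgroup ?C G"
    proof (rule subgroupI)
      fix y assume "y \<in> ?C"
      moreover from this have "commutator G x (y [^] (-1::int)) = \<one>"
        using x by (simp only: commutator_int_pow_right mem_Collect_eq int_pow_one)
      moreover have "y [^] (-1::int) = inv y" using \<open>y \<in> ?C\<close> by (simp add: int_pow_neg)
      ultimately show "inv y \<in> ?C" by simp
    qed (use x one in \<open>auto simp: commutator_mult_right\<close>)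
    moreover have "S \<subseteq> ?C" using that E S(2) by auto
    ultimately have "carrier G \<subseteq> ?C" using generate_subgroup_incl[of S ?C] S(3) by simp
    then have "x \<otimes> y = y \<otimes> x" if "y \<in> carrier G" for y
      using commutator_eq_one_iff[OF x that] that by blast
    then show ?thesis using x by (simp only: group_center_def mem_Collect_eq) blast
  qed
  show "carrier G \<subseteq> isolator G (\<theta> ` carrier G)"
  proof
    fix x assume x: "x \<in> carrier G"
    let ?P = "orbit_product G \<theta> x"
    have P: "?P n c \<in> carrier G" for n c
      by (induction n arbitrary: c) (use x in auto)
    have iter: "(\<theta> ^^ k) u \<in> carrier G" if "u \<in> carrier G" for k u
      by (induction k) (use that in auto)
    have iter_mult: "(\<theta> ^^ k) (u \<otimes> v) = (\<theta> ^^ k) u \<otimes> (\<theta> ^^ k) v"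
      if "u \<in> carrier G" "v \<in> carrier G" for k u v
      by (induction k) (use that iter in auto)
    have iter_pow: "(\<theta> ^^ k) (u [^] m) = (\<theta> ^^ k) u [^] m" if "u \<in> carrier G" for k u and m :: int
      by (induction k) (use that iter in \<open>auto simp: \<theta>.hom_int_pow\<close>)
    have iter_one: "(\<theta> ^^ k) \<one> = \<one>" for k by (induction k) auto
    \<comment> \<open>The outer iterate \<open>\<theta> ^^ k\<close> generalises the claim for the
      induction, because each unfolding of the product adds one application of
      \<open>\<theta>\<close>.\<close>
    have EP: "E ((\<theta> ^^ k) (?P n c)) s = (\<Sum>i<n. c i * E ((\<theta> ^^ (k + i)) x) s)"
      if s: "s \<in> carrier G" for k n c s
    proof (induction n arbitrary: k c)
      case 0
      then show ?case using E_one[OF s] iter_one by simp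
    next
      case (Suc n)
      let ?Q = "?P n (\<lambda>i. c (Suc i))"
      have Q: "?Q \<in> carrier G" "\<theta> ?Q \<in> carrier G" using P by auto
      have "(\<theta> ^^ k) (?P (Suc n) c) = (\<theta> ^^ k) x [^] c 0 \<otimes> (\<theta> ^^ Suc k) ?Q"
        using x Q by (simp add: iter_mult iter_pow funpow_swap1)
      then have "E ((\<theta> ^^ k) (?P (Suc n) c)) s = c 0 * E ((\<theta> ^^ k) x) s + E ((\<theta> ^^ Suc k) ?Q) s"
        using E_mult[OF _ _ s, of "(\<theta> ^^ k) x [^] c 0" "(\<theta> ^^ Suc k) ?Q"] E_pow[OF _ s]
          iter[OF x] iter[OF Q(1)] by (simp del: funpow.simps)
      also have "E ((\<theta> ^^ Suc k) ?Q) s = (\<Sum>i<n. c (Suc i) * E ((\<theta> ^^ (Suc k + i)) x) s)"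
        by (rule Suc.IH)
      finally show ?case by (simp only: sum.lessThan_Suc_shift add_0_right add_Suc_right add_Suc)
    qed
    \<comment> \<open>While the leading coefficient is zero the product is \<open>\<theta>\<close>
      of a shorter one, and \<open>reflect\<close> strips this \<open>\<theta>\<close>; the nonzero
      coefficient bounds the descent.\<close>
    have reduce: "\<exists>m\<noteq>0. \<exists>y\<in>carrier G. x [^] (m::int) \<otimes> \<theta> y \<in> group_center G"
      if "i < n" "c i \<noteq> 0" "?P n c \<in> group_center G" for n c i
      using that
    proof (induction n arbitrary: c i)
      case (Suc n)
      let ?Q = "?P n (\<lambda>i. c (Suc i))"
      show ?case
      proof (cases "c 0 = 0")
        case False
        then show ?thesis using Suc.prems(3) P[of n "\<lambda>i. c (Suc i)"] by auto
      next
        case True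
        then obtain j where j: "i = Suc j" using Suc.prems(2) by (cases i) auto
        have "\<theta> ?Q \<in> group_center G" using Suc.prems(3) True P by simp
        then have "?Q \<in> group_center G" using reflect P by blast
        then show ?thesis using Suc.IH[of j "\<lambda>i. c (Suc i)"] Suc.prems j by simp
      qed
    qed simp
    \<comment> \<open>\<open>{..card S}\<close> has \<open>card S + 1\<close> elements, one orbit
      point more than there are coordinates.\<close>
    obtain c :: "nat \<Rightarrow> int" where c: "\<exists>i\<in>{..card S}. c i \<noteq> 0"
      "\<And>s. s \<in> S \<Longrightarrow> (\<Sum>i\<in>{..card S}. c i * E ((\<theta> ^^ i) x) s) = 0"
      using int_vectors_dependent[OF S(1), of "{..card S}" "\<lambda>i s. E ((\<theta> ^^ i) x) s"] by auto
    have "?P (Suc (card S)) c \<in> group_center G"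
    proof (rule centralI[OF P])
      fix s assume s: "s \<in> S"
      then have "s \<in> carrier G" using S(2) by blast
      from EP[OF this, of 0 "Suc (card S)" c] c(2)[OF s]
      show "E (?P (Suc (card S)) c) s = 0" by (simp only: lessThan_Suc_atMost funpow_0 add_0)
    qed
    moreover obtain i where "i < Suc (card S)" "c i \<noteq> 0"
      using c(1) by (auto simp: less_Suc_eq_le)
    ultimately obtain m :: int and y where m: "m \<noteq> 0" "y \<in> carrier G" "x [^] m \<otimes> \<theta> y \<in> group_center G"
      using reduce by blast
    let ?u = "x [^] m \<otimes> \<theta> y"
    obtain k :: int where k: "?u = z [^] k" using z_generates[OF m(3)] by blast
    have c\<theta>: "\<theta> y \<in> carrier G" and uc: "?u \<in> carrier G" using m(2) x by auto
    \<comment> \<open>The central remainder \<open>z [^] k\<close> may lie outside the image, but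
      its \<open>l\<close>-th power is \<open>\<theta> (z [^] k)\<close>; hence the extra factor
      \<open>l\<close> in the exponent.\<close>
    have "x [^] m = ?u \<otimes> inv (\<theta> y)" using x c\<theta> by (simp add: m_assoc)
    then have "x [^] (m * l) = (?u \<otimes> inv (\<theta> y)) [^] l" using x by (metis int_pow_pow)
    also have "\<dots> = ?u [^] l \<otimes> inv (\<theta> y) [^] l"
      using uc c\<theta> by (intro int_pow_mult_distrib center_mult_commute[OF m(3)]) auto
    also have "?u [^] l = \<theta> (z [^] k)"
      unfolding k by (simp add: \<theta>.hom_int_pow l int_pow_pow mult.commute)
    also have "inv (\<theta> y) [^] l = \<theta> (inv y [^] l)" using m(2) by (simp add: \<theta>.hom_int_pow)
    finally have "x [^] (m * l) = \<theta> (z [^] k \<otimes> inv y [^] l)" using m(2) by simp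
    moreover have "z [^] k \<otimes> inv y [^] l \<in> carrier G" using m(2) by simp
    ultimately have in_image: "x [^] (m * l) \<in> \<theta> ` carrier G" by (rule image_eqI)
    have ml: "m * l \<noteq> 0" using m(1) l0 by simp
    have "x [^] (nat \<bar>m * l\<bar>) \<in> \<theta> ` carrier G"
    proof (cases "m * l" rule: int_cases2)
      case (nonneg n)
      then show ?thesis using in_image by (simp add: int_pow_int)
    next
      case (nonpos n)
      have "inv (x [^] (m * l)) \<in> \<theta> ` carrier G"
        using subgroup.m_inv_closed[OF \<theta>.img_is_subgroup in_image] .
      then show ?thesis using x unfolding nonpos by (simp add: int_pow_neg_int)
    qed
    moreover have "nat \<bar>m * l\<bar> \<ge> 1" using ml by linarith
    ultimately show "x \<in> isolator G (\<theta> ` carrier G)" using x unfolding isolator_def by blast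
  qed
qed

lemma isolator_image_trans:
  assumes "group M" "group N" "f \<in> hom G M" "g \<in> hom M N"
    and "isolator M (f ` carrier G) = carrier M" "isolator N (g ` carrier M) = carrier N"
  shows "isolator N ((g \<circ> f) ` carrier G) = carrier N"
proof
  interpret M: group M by fact
  interpret N: group N by fact
  interpret g: group_hom M N g
    using assms(4) by (simp add: group_hom_def group_hom_axioms_def M.is_group N.is_group)
  show "isolator N ((g \<circ> f) ` carrier G) \<subseteq> carrier N" by (auto simp: isolator_def)
  show "carrier N \<subseteq> isolator N ((g \<circ> f) ` carrier G)"
  proof
    fix x assume x: "x \<in> carrier N"
    then have "x \<in> isolator N (g ` carrier M)" using assms(6) by simp
    then obtain n :: nat and y where n: "n \<ge> 1" "y \<in> carrier M" "x [^]\<^bsub>N\<^esub> n = g y"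
      unfolding isolator_def by blast
    then have "y \<in> isolator M (f ` carrier G)" using assms(5) by simp
    then obtain m :: nat and w where m: "m \<ge> 1" "w \<in> carrier G" "y [^]\<^bsub>M\<^esub> m = f w"
      unfolding isolator_def by blast
    have "x [^]\<^bsub>N\<^esub> (n * m) = (g \<circ> f) w"
      using n(2) by (simp add: N.nat_pow_pow[OF x, symmetric] n(3) g.hom_nat_pow[symmetric] m(3))
    moreover have "n * m \<ge> 1" using n(1) m(1) by simp
    ultimately show "x \<in> isolator N ((g \<circ> f) ` carrier G)" using x m(2) unfolding isolator_def by blast
  qed
qed

lemma mon_compose:
  assumes "f \<in> mon G H" "g \<in> mon H K"
  shows "g \<circ> f \<in> mon G K"
  using assms by (auto simp: mon_def hom_def Pi_iff inj_on_def)


section \<open>Geometric equivalence through embeddings\<close>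

text \<open>Composition with \<open>j\<close> turns points of \<open>G\<close> into points of
  \<open>H\<close> with the same kernels, so the closure in \<open>H\<close> is an intersection over
  at least these kernels.\<close>

lemma geom_closure_mono_of_embedding:
  assumes "j \<in> mon G H" "group G" "group H"
  shows "geom_closure \<Theta> X H T \<subseteq> geom_closure \<Theta> X G T"
proof -
  let ?W = "variety_free_group \<Theta> X"
  have "j \<circ> \<mu> \<in> hom_points \<Theta> X H T \<and> kernel ?W H (j \<circ> \<mu>) = kernel ?W G \<mu>" if "\<mu> \<in> hom_points \<Theta> X G T" for \<mu>
  proof -
    have \<mu>: "\<mu> \<in> hom ?W G" "T \<subseteq> kernel ?W G \<mu>" using that by (auto simp: hom_points_def)
    have j: "j \<in> hom G H" "inj_on j (carrier G)" using assms(1) by (auto simp: mon_def)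
    have "j a = \<one>\<^bsub>H\<^esub> \<longleftrightarrow> a = \<one>\<^bsub>G\<^esub>" if "a \<in> carrier G" for a
      using inj_on_one_iff'[OF j(1) assms(2,3)] j(2) hom_one[OF j(1) assms(2,3)] that by auto
    then have "kernel ?W H (j \<circ> \<mu>) = kernel ?W G \<mu>"
      using \<mu>(1) by (auto simp: kernel_def hom_def)
    then show ?thesis using \<mu> hom_compose[OF \<mu>(1) j(1)] by (simp add: hom_points_def)
  qed
  then show ?thesis unfolding geom_closure_def by blast
qed

lemma geom_equivalent_of_embeddings:
  assumes "j \<in> mon G H" "k \<in> mon H G" "group G" "group H"
  shows "geom_equivalent \<Theta> G H"
  unfolding geom_equivalent_def
  using geom_closure_mono_of_embedding[OF assms(1,3,4)] geom_closure_mono_of_embedding[OF assms(2,4,3)]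
  by blast

text \<open>Apply the equality of closures to the set of all relations between generators of \<open>G\<close>,
  which is its own closure in \<open>G\<close>.\<close>

lemma geom_equivalent_separates:
  fixes G :: "('a, 'm) monoid_scheme" and H :: "('b, 'n) monoid_scheme"
  assumes "geom_equivalent \<Theta> G H"
    and "finitely_generated_group G" "in_variety \<Theta> G" "in_variety \<Theta> H"
    and w: "w \<in> carrier G" "w \<noteq> \<one>\<^bsub>G\<^esub>"
  obtains \<phi> where "\<phi> \<in> hom G H" "\<phi> w \<noteq> \<one>\<^bsub>H\<^esub>"
proof -
  interpret G: group G using assms(3) by (simp add: in_variety_def)
  interpret H: group H using assms(4) by (simp add: in_variety_def)
  obtain S where S: "finite S" "S \<subseteq> carrier G" "generate G S = carrier G"
    using assms(2) by (auto simp: finitely_generated_group_def)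
  \<comment> \<open>Geometric equivalence ranges over finite sets of naturals, so the generators are
    numbered.\<close>
  define X where "X = {0..<card S}"
  obtain e where e: "bij_betw e X S" unfolding X_def using ex_bij_betw_nat_finite[OF S(1)] by blast
  have eS: "e ` X = S" using e by (simp add: bij_betw_def)
  define W where "W = variety_free_group \<Theta> X"
  interpret W: group W
    using in_variety_variety_free_group[of \<Theta> X] by (simp add: in_variety_def W_def)
  have "e \<in> X \<rightarrow> carrier G" using eS S(2) by auto
  then obtain h where h: "h \<in> hom W G" "\<And>x. x \<in> X \<Longrightarrow> h (variety_free_gen \<Theta> X x) = e x"
    using variety_free_group_universal[OF assms(3), of e X, folded W_def] by blast
  interpret h: group_hom W G h
    using h(1) by (simp add: group_hom_def group_hom_axioms_def W.is_group G.is_group)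
  have gens: "carrier W = generate W (variety_free_gen \<Theta> X ` X)"
    unfolding W_def by (rule variety_free_group_generated)
  then have "variety_free_gen \<Theta> X ` X \<subseteq> carrier W" by (auto intro: generate.incl)
  from h.generate_img[OF this] have surj: "h ` carrier W = carrier G"
    unfolding gens[symmetric] image_image using h(2) eS S(3) by (simp cong: image_cong)
  define T where "T = kernel W G h"
  have T: "T \<subseteq> carrier W" by (auto simp: T_def kernel_def)
  obtain u where u: "u \<in> carrier W" "h u = w" using surj w(1) by (metis imageE)
  have "h \<in> hom_points \<Theta> X G T" using h(1) by (simp add: hom_points_def T_def W_def)
  then have "geom_closure \<Theta> X G T \<subseteq> T" by (auto simp: geom_closure_def T_def W_def)
  moreover have "u \<notin> T" using u w(2) by (simp add: T_def kernel_def)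
  ultimately have "u \<notin> geom_closure \<Theta> X H T"
    using assms(1) T by (auto simp: geom_equivalent_def X_def W_def)
  then obtain \<mu> where \<mu>: "\<mu> \<in> hom W H" "T \<subseteq> kernel W H \<mu>" "u \<notin> kernel W H \<mu>"
    by (auto simp: geom_closure_def hom_points_def W_def)
  interpret \<mu>: group_hom W H \<mu>
    using \<mu>(1) by (simp add: group_hom_def group_hom_axioms_def W.is_group H.is_group)
  \<comment> \<open>\<open>\<mu>\<close> kills the kernel of the surjection \<open>h\<close>, so it
    descends to \<open>G\<close>; \<open>\<phi>\<close> is the induced map.\<close>
  have factor: "\<mu> a = \<mu> b" if "a \<in> carrier W" "b \<in> carrier W" "h a = h b" for a b
  proof -
    have "a \<otimes>\<^bsub>W\<^esub> inv\<^bsub>W\<^esub> b \<in> T" using that by (simp add: T_def kernel_def)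
    then have "\<mu> (a \<otimes>\<^bsub>W\<^esub> inv\<^bsub>W\<^esub> b) = \<one>\<^bsub>H\<^esub>" using \<mu>(2) by (auto simp: kernel_def)
    then show ?thesis using that H.inv_solve_right'[of "\<one>\<^bsub>H\<^esub>" "\<mu> a" "\<mu> b"] by simp
  qed
  define \<phi> where "\<phi> x = \<mu> (inv_into (carrier W) h x)" for x
  have lift: "\<phi> (h a) = \<mu> a" if "a \<in> carrier W" for a
    unfolding \<phi>_def using that
    by (intro factor inv_into_into f_inv_into_f imageI)
  have "\<phi> \<in> hom G H"
  proof (rule homI)
    fix x y assume "x \<in> carrier G" "y \<in> carrier G"
    then obtain a b where ab: "a \<in> carrier W" "x = h a" "b \<in> carrier W" "y = h b"
      using surj by (metis (no_types) imageE)
    then show "\<phi> x \<in> carrier H" using lift by simp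
    have "\<phi> (h (a \<otimes>\<^bsub>W\<^esub> b)) = \<mu> a \<otimes>\<^bsub>H\<^esub> \<mu> b" using ab lift[of "a \<otimes>\<^bsub>W\<^esub> b"] by simp
    then show "\<phi> (x \<otimes>\<^bsub>G\<^esub> y) = \<phi> x \<otimes>\<^bsub>H\<^esub> \<phi> y" using ab lift by simp
  qed
  moreover have "\<phi> w \<noteq> \<one>\<^bsub>H\<^esub>" using lift[OF u(1)] u \<mu>(3) by (simp add: kernel_def)
  ultimately show ?thesis by (rule that)
qed

section \<open>The equivalence of the two conditions\<close>

lemma cyclic_center_groupI:
  fixes G (structure)
  assumes "nilpotent_of_class 2 G" "torsion_free_group G" "cyclic_group (G\<lparr>carrier := group_center G\<rparr>)"
  obtains z where "cyclic_center_group G z"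
proof -
  interpret two_step_group G using nilpotent_of_class_2D(1)[OF assms(1)] .
  interpret Z: group "G\<lparr>carrier := group_center G\<rparr>"
    by (rule subgroup.subgroup_is_group[OF subgroup_center is_group])
  from assms(3) obtain z where z: "z \<in> group_center G"
    "group_center G = range (\<lambda>n::int. z [^]\<^bsub>G\<lparr>carrier := group_center G\<rparr>\<^esub> n)"
    unfolding Z.cyclic_group by auto
  have "\<exists>k::int. w = z [^] k" if "w \<in> group_center G" for w
  proof -
    have "w \<in> range (\<lambda>n::int. z [^]\<^bsub>G\<lparr>carrier := group_center G\<rparr>\<^esub> n)" using that z(2) by simp
    then show ?thesis by (auto simp: int_pow_consistent[OF subgroup_center z(1), symmetric])
  qed
  then have "cyclic_center_group G z"
    using z(1) assms(2) nilpotent_of_class_2D(2)[OF assms(1)]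
    by (intro cyclic_center_group.intro cyclic_center_group_axioms.intro two_step_group_axioms) auto
  then show ?thesis by (rule that)
qed

theorem theorem3:
  fixes G1 :: "('a, 'm) monoid_scheme" and G2 :: "('b, 'n) monoid_scheme"
    and M1 :: "('c, 'k) monoid_scheme" and M2 :: "('d, 'l) monoid_scheme"
    and \<Theta> :: "nat gword set"
  assumes "finitely_generated_group G1" and "finitely_generated_group G2"
    and "torsion_free_group G1" and "torsion_free_group G2"
    and "nilpotent_of_class 2 G1" and "nilpotent_of_class 2 G2"
    and "cyclic_group (G1\<lparr>carrier := group_center G1\<rparr>)"
    and "cyclic_group (G2\<lparr>carrier := group_center G2\<rparr>)"
    and "in_variety \<Theta> G1" and "in_variety \<Theta> G2"
    and "maltsev_completion G1 M1" and "maltsev_completion G2 M2"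
  shows "geom_equivalent \<Theta> G1 G2 \<longleftrightarrow> M1 \<cong> M2"
proof -
  obtain z1 where "cyclic_center_group G1 z1"
    by (rule cyclic_center_groupI[OF assms(5,3,7)])
  then interpret G1: cyclic_center_group G1 z1 .
  obtain z2 where "cyclic_center_group G2 z2"
    by (rule cyclic_center_groupI[OF assms(6,4,8)])
  then interpret G2: cyclic_center_group G2 z2 .
  note two_step = G1.two_step_group_axioms G2.two_step_group_axioms
  obtain \<iota>1 where \<iota>1: "\<iota>1 \<in> mon G1 M1" "root_group M1" "two_step_group M1"
    "isolator M1 (\<iota>1 ` carrier G1) = carrier M1"
    by (rule maltsev_completionD[OF assms(11) two_step(1)])
  obtain \<iota>2 where \<iota>2: "\<iota>2 \<in> mon G2 M2" "root_group M2" "two_step_group M2"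
    "isolator M2 (\<iota>2 ` carrier G2) = carrier M2"
    by (rule maltsev_completionD[OF assms(12) two_step(2)])
  interpret M1: root_group M1 by (rule \<iota>1)
  interpret M2: root_group M2 by (rule \<iota>2)
  show ?thesis
  proof
    assume eq: "geom_equivalent \<Theta> G1 G2"
    then have eq': "geom_equivalent \<Theta> G2 G1" by (simp add: geom_equivalent_def)
    obtain \<phi> where "\<phi> \<in> hom G1 G2" "\<phi> z1 \<noteq> \<one>\<^bsub>G2\<^esub>"
      by (rule geom_equivalent_separates[OF eq assms(1,9,10) G1.z_closed G1.z_neq_one])
    then have \<phi>: "\<phi> \<in> mon G1 G2" by (rule G1.mon_of_z_neq_one[OF G2.is_group assms(4)])
    obtain \<psi> where "\<psi> \<in> hom G2 G1" "\<psi> z2 \<noteq> \<one>\<^bsub>G1\<^esub>"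
      by (rule geom_equivalent_separates[OF eq' assms(2,10,9) G2.z_closed G2.z_neq_one])
    then have \<psi>: "\<psi> \<in> mon G2 G1" by (rule G2.mon_of_z_neq_one[OF G1.is_group assms(3)])
    \<comment> \<open>The image of the composite lies in the image of \<open>\<phi>\<close>, so
      elements with a power in the former have one in the latter; this replaces a comparison of
      ranks.\<close>
    have "isolator G2 ((\<phi> \<circ> \<psi>) ` carrier G2) = carrier G2"
      by (rule G2.isolator_injective_endomorphism[OF assms(2) mon_compose[OF \<psi> \<phi>]])
    moreover have "(\<phi> \<circ> \<psi>) ` carrier G2 \<subseteq> \<phi> ` carrier G1"
      using \<psi> by (auto simp: mon_def hom_def)
    ultimately have "isolator G2 (\<phi> ` carrier G1) = carrier G2"
      unfolding isolator_def by blast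
    then have "isolator M2 ((\<iota>2 \<circ> \<phi>) ` carrier G1) = carrier M2"
      using \<phi> \<iota>2(1,4) by (intro isolator_image_trans[OF G2.is_group M2.is_group]) (auto simp: mon_def)
    then show "M1 \<cong> M2"
      by (rule completion_iso[OF two_step(1) \<iota>1(2) \<iota>2(2) \<iota>1(1,4) mon_compose[OF \<phi> \<iota>2(1)]])
  next
    assume "M1 \<cong> M2"
    then obtain \<sigma> where \<sigma>: "\<sigma> \<in> iso M1 M2" by (auto simp: is_iso_def)
    have \<sigma>_mon: "\<sigma> \<in> mon M1 M2" and \<sigma>_surj: "\<sigma> ` carrier M1 = carrier M2"
      using \<sigma> by (auto simp: mon_def iso_def bij_betw_def)
    have "isolator M2 (carrier M2) = carrier M2" by (auto simp: isolator_def intro!: exI[of _ 1])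
    \<comment> \<open>Carried along \<open>\<sigma>\<close>, \<open>G1\<close> becomes a second
      subgroup of \<open>M2\<close> with full isolator, and \<open>M2\<close> serves as a completion
      of both groups.\<close>
    then have iso: "isolator M2 ((\<sigma> \<circ> \<iota>1) ` carrier G1) = carrier M2"
      using \<sigma>_mon \<sigma>_surj \<iota>1(1,4)
      by (intro isolator_image_trans[OF M1.is_group M2.is_group]) (auto simp: mon_def)
    have mon: "\<sigma> \<circ> \<iota>1 \<in> mon G1 M2" by (rule mon_compose[OF \<iota>1(1) \<sigma>_mon])
    obtain j where j: "j \<in> mon G1 G2"
      using embedding_of_common_completion[OF assms(1) G1.is_group G2.is_group \<iota>2(2,3) mon iso \<iota>2(1,4)]
      by blast
    obtain k where k: "k \<in> mon G2 G1"
      using embedding_of_common_completion[OF assms(2) G2.is_group G1.is_group \<iota>2(2,3) \<iota>2(1,4) mon iso]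
      by blast
    show "geom_equivalent \<Theta> G1 G2"
      by (rule geom_equivalent_of_embeddings[OF j k G1.is_group G2.is_group])
  qed
qed

end
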